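(* Let $X$ be a generic primitively polarized real $K3$ surface of genus $g$, let $e_{\mathbb R}$ be the Euler characteristic of its real part, $e_{\mathbb C}=24$, and let $r_g(X)$ be the number of real rational curves in the divisor class of the primitive polarization of $X$. Then $$\phi(g)=|w_g|\le r_g(X)\le c_g=\psi(g),$$ where, as $g\to\infty$, $$\log\psi(g)=4\pi\sqrt g+o(\sqrt g),$$ and, for a fixed $e_{\mathbb R}\neq 0$, $$\log\phi(g)=4\pi\rho\sqrt g+o(\sqrt g)$$ with $\rho=\frac12$ if $e_{\mathbb R}>0$ and $\rho=\sqrt{\frac{e_{\mathbb C}-3e_{\mathbb R}}{4e_{\mathbb C}}}$ if $e_{\mathbb R}<0$, while for $e_{\mathbb R}=0$ $$\log\phi(2g)=2\pi\sqrt{2g}+o(\sqrt g).$$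
   Context: Setting: $X$ is a generic real $K3$ surface admitting a complete real $g$-dimensional linear system of curves of genus $g$; if $g\ge 2$, in addition $X$ has Picard rank $1$ and the curves in the linear system belong to a primitive divisor class (the primitive polarization). Genericity ensures that all rational curves in the linear system are nodal. $c_g$ is the number of complex rational curves in this linear system, and $w_g=n_+-n_-$ is the number of real rational curves in it counted with Welschinger sign: $n_+$ (resp. $n_-$) is the number of real rational curves in the system having an even (resp. odd) number of real solitary points. $e_{\mathbb R}$ is the Euler characteristic of the real part $X_{\mathbb R}$ (always even, between $-18$ and $20$) and $e_{\mathbb C}=24$ is the Euler characteristic of $X$. It is known (taken as given) that $c_g$ depends only on $g$, that $w_g$ depends only on $g$ and $e_{\mathbb R}$, and that $$\sum_{g\ge 0} c_g q^g=\prod_{s\ge 1}\frac{1}{(1-q^{s})^{e_{\mathbb C}}},\qquad \sum_{g\ge 0} w_g q^g=\prod_{r\ge 1}\frac{1}{(1+q^r)^{e_{\mathbb R}}}\prod_{s\ge 1}\frac{1}{(1-q^{2s})^{\frac{e_{\mathbb C}-e_{\mathbb R}}{2}}}.$$ For fixed $e_{\mathbb R}$, $(w_g)_{g\ge0}$ denotes the sequence of coefficients of the second series. *)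

theory Defs
  imports
    "HOL-Analysis.Analysis"
    "HOL-Homology.Homology"
    "HOL-Computational_Algebra.Formal_Power_Series"
    "HOL-Library.Landau_Symbols"
    "HOL-Library.Function_Algebras"
begin

section \<open>Ranks, Betti numbers, Euler characteristic\<close>

definition int_independent :: "('a, 'b) monoid_scheme \<Rightarrow> 'a set \<Rightarrow> bool" where
  "int_independent G S \<longleftrightarrow> finite S \<and> S \<subseteq> carrier G \<and>
     (\<forall>k :: 'a \<Rightarrow> int. finprod G (\<lambda>x. x [^]\<^bsub>G\<^esub> k x) S = \<one>\<^bsub>G\<^esub> \<longrightarrow> (\<forall>x\<in>S. k x = 0))"

definition free_rank :: "('a, 'b) monoid_scheme \<Rightarrow> enat" where
  "free_rank G = Sup {enat (card S) | S. int_independent G S}"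

definition primitive_in :: "('a, 'b) monoid_scheme \<Rightarrow> 'a \<Rightarrow> bool" where
  "primitive_in G a \<longleftrightarrow> a \<in> carrier G \<and> (\<forall>b\<in>carrier G. \<forall>n::nat. b [^]\<^bsub>G\<^esub> n = a \<longrightarrow> n = 1)"

definition betti :: "nat \<Rightarrow> 'a topology \<Rightarrow> enat" where
  "betti i T = free_rank (homology_group (int i) T)"

text \<open>Only used for compact manifolds, where the sum is finite with finite terms.\<close>
definition euler_char :: "'a topology \<Rightarrow> int" where
  "euler_char T = (\<Sum>i | betti i T \<noteq> 0. (- 1) ^ i * int (the_enat (betti i T)))"


section \<open>Complex surfaces\<close>

definition holomorphic2_on :: "(complex \<times> complex \<Rightarrow> complex) \<Rightarrow> (complex \<times> complex) set \<Rightarrow> bool" where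
  "holomorphic2_on F S \<longleftrightarrow> (\<forall>z\<in>S. \<exists>a b. (F has_derivative (\<lambda>(u, v). a * u + b * v)) (at z))"

definition pd1 :: "(complex \<times> complex \<Rightarrow> complex) \<Rightarrow> complex \<times> complex \<Rightarrow> complex" where
  "pd1 F z = deriv (\<lambda>u. F (u, snd z)) (fst z)"

definition pd2 :: "(complex \<times> complex \<Rightarrow> complex) \<Rightarrow> complex \<times> complex \<Rightarrow> complex" where
  "pd2 F z = deriv (\<lambda>v. F (fst z, v)) (snd z)"

definition jacobian :: "(complex \<times> complex \<Rightarrow> complex \<times> complex) \<Rightarrow> complex \<times> complex \<Rightarrow> complex" where
  "jacobian F z = pd1 (fst \<circ> F) z * pd2 (snd \<circ> F) z - pd2 (fst \<circ> F) z * pd1 (snd \<circ> F) z"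

record 'a surface =
  top_of :: "'a topology"
  atlas :: "('a set \<times> ('a \<Rightarrow> complex \<times> complex)) set"

abbreviation points :: "'a surface \<Rightarrow> 'a set" where
  "points X \<equiv> topspace (top_of X)"

definition complex_surface :: "'a surface \<Rightarrow> bool" where
  "complex_surface X \<longleftrightarrow>
     Hausdorff_space (top_of X) \<and> second_countable (top_of X) \<and>
     (\<Union>(U, \<phi>)\<in>atlas X. U) = points X \<and>
     (\<forall>(U, \<phi>)\<in>atlas X. openin (top_of X) U \<and> open (\<phi> ` U) \<and>
        homeomorphic_map (subtopology (top_of X) U) (top_of_set (\<phi> ` U)) \<phi>) \<and>
     (\<forall>(U, \<phi>)\<in>atlas X. \<forall>(V, \<psi>)\<in>atlas X.
        holomorphic2_on (fst \<circ> \<psi> \<circ> inv_into U \<phi>) (\<phi> ` (U \<inter> V)) \<and>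
        holomorphic2_on (snd \<circ> \<psi> \<circ> inv_into U \<phi>) (\<phi> ` (U \<inter> V)))"

definition holo_on :: "'a surface \<Rightarrow> 'a set \<Rightarrow> ('a \<Rightarrow> complex) \<Rightarrow> bool" where
  "holo_on X W f \<longleftrightarrow> openin (top_of X) W \<and>
     (\<forall>(U, \<phi>)\<in>atlas X. holomorphic2_on (f \<circ> inv_into U \<phi>) (\<phi> ` (U \<inter> W)))"

definition simply_connected_space :: "'a topology \<Rightarrow> bool" where
  "simply_connected_space T \<longleftrightarrow> path_connected_space T \<and>
     (\<forall>l. continuous_map (top_of_set (sphere (0::complex) 1)) T l \<longrightarrow>
        (\<exists>a. homotopic_with (\<lambda>_. True) (top_of_set (sphere 0 1)) T l (\<lambda>_. a)))"

text \<open>A nowhere vanishing holomorphic 2-form, given in each chart \<open>(U, \<phi>)\<close> by its coefficient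
  with respect to \<open>d\<phi>\<^sub>1 \<and> d\<phi>\<^sub>2\<close>.\<close>
definition trivial_canonical_bundle :: "'a surface \<Rightarrow> bool" where
  "trivial_canonical_bundle X \<longleftrightarrow> (\<exists>\<omega>.
     (\<forall>(U, \<phi>)\<in>atlas X. holo_on X U (\<omega> (U, \<phi>)) \<and> (\<forall>p\<in>U. \<omega> (U, \<phi>) p \<noteq> 0)) \<and>
     (\<forall>(U, \<phi>)\<in>atlas X. \<forall>(V, \<psi>)\<in>atlas X. \<forall>p\<in>U \<inter> V.
        \<omega> (U, \<phi>) p = \<omega> (V, \<psi>) p * jacobian (\<psi> \<circ> inv_into U \<phi>) (\<phi> p)))"

definition K3_surface :: "'a surface \<Rightarrow> bool" where
  "K3_surface X \<longleftrightarrow> complex_surface X \<and> points X \<noteq> {} \<and> compact_space (top_of X) \<and>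
     simply_connected_space (top_of X) \<and> trivial_canonical_bundle X"


section \<open>Real structures\<close>

definition real_structure :: "'a surface \<Rightarrow> ('a \<Rightarrow> 'a) \<Rightarrow> bool" where
  "real_structure X \<sigma> \<longleftrightarrow> continuous_map (top_of X) (top_of X) \<sigma> \<and>
     (\<forall>p\<in>points X. \<sigma> (\<sigma> p) = p) \<and>
     (\<forall>W f. holo_on X W f \<longrightarrow> holo_on X {p\<in>points X. \<sigma> p \<in> W} (\<lambda>p. cnj (f (\<sigma> p))))"

definition real_part :: "'a surface \<Rightarrow> ('a \<Rightarrow> 'a) \<Rightarrow> 'a set" where
  "real_part X \<sigma> = {p\<in>points X. \<sigma> p = p}"

definition euler_real :: "'a surface \<Rightarrow> ('a \<Rightarrow> 'a) \<Rightarrow> int" where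
  "euler_real X \<sigma> = euler_char (subtopology (top_of X) (real_part X \<sigma>))"


section \<open>Holomorphic line bundles\<close>

text \<open>A line bundle is given by a cocycle on an open cover. Without loss of generality the cover is
  indexed by the points of the surface, the point \<open>x\<close> lying in the member \<open>nbhd L x\<close>.\<close>
record 'a line_bundle =
  nbhd :: "'a \<Rightarrow> 'a set"
  cocycle :: "'a \<Rightarrow> 'a \<Rightarrow> 'a \<Rightarrow> complex"

definition holo_line_bundle :: "'a surface \<Rightarrow> 'a line_bundle \<Rightarrow> bool" where
  "holo_line_bundle X L \<longleftrightarrow>
     (\<forall>x\<in>points X. openin (top_of X) (nbhd L x) \<and> x \<in> nbhd L x) \<and>
     (\<forall>x\<in>points X. \<forall>y\<in>points X. holo_on X (nbhd L x \<inter> nbhd L y) (cocycle L x y) \<and>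
        (\<forall>p\<in>nbhd L x \<inter> nbhd L y. cocycle L x y p \<noteq> 0)) \<and>
     (\<forall>x\<in>points X. \<forall>y\<in>points X. \<forall>z\<in>points X. \<forall>p\<in>nbhd L x \<inter> nbhd L y \<inter> nbhd L z.
        cocycle L x y p * cocycle L y z p = cocycle L x z p)"

definition bundle_iso :: "'a surface \<Rightarrow> 'a line_bundle rel" where
  "bundle_iso X = {(L, M). holo_line_bundle X L \<and> holo_line_bundle X M \<and> (\<exists>h.
     (\<forall>x\<in>points X. holo_on X (nbhd L x \<inter> nbhd M x) (h x) \<and>
        (\<forall>p\<in>nbhd L x \<inter> nbhd M x. h x p \<noteq> 0)) \<and>
     (\<forall>x\<in>points X. \<forall>y\<in>points X. \<forall>p\<in>nbhd L x \<inter> nbhd M x \<inter> nbhd L y \<inter> nbhd M y.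
        h x p * cocycle L x y p = cocycle M x y p * h y p))}"

definition bundle_tensor :: "'a line_bundle \<Rightarrow> 'a line_bundle \<Rightarrow> 'a line_bundle" where
  "bundle_tensor L M = \<lparr>nbhd = (\<lambda>x. nbhd L x \<inter> nbhd M x),
                        cocycle = (\<lambda>x y p. cocycle L x y p * cocycle M x y p)\<rparr>"

definition trivial_bundle :: "'a surface \<Rightarrow> 'a line_bundle" where
  "trivial_bundle X = \<lparr>nbhd = (\<lambda>x. points X), cocycle = (\<lambda>x y p. 1)\<rparr>"

definition Pic :: "'a surface \<Rightarrow> 'a line_bundle set monoid" where
  "Pic X = \<lparr>carrier = {L. holo_line_bundle X L} // bundle_iso X,
            monoid.mult = (\<lambda>A B. \<Union>L\<in>A. \<Union>M\<in>B. bundle_iso X `` {bundle_tensor L M}),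
            one = bundle_iso X `` {trivial_bundle X}\<rparr>"

text \<open>The Picard group of a K3 surface equals its Neron-Severi group, so this is the Picard number.\<close>
definition picard_rank :: "'a surface \<Rightarrow> enat" where
  "picard_rank X = free_rank (Pic X)"

text \<open>The complex conjugate of the pull-back of \<open>L\<close> by the anti-holomorphic \<open>\<sigma>\<close>, again holomorphic.
  The zero divisors of its sections are the images under \<open>\<sigma>\<close> of those of the sections of \<open>L\<close>.\<close>
definition conj_bundle :: "'a surface \<Rightarrow> ('a \<Rightarrow> 'a) \<Rightarrow> 'a line_bundle \<Rightarrow> 'a line_bundle" where
  "conj_bundle X \<sigma> L = \<lparr>nbhd = (\<lambda>x. {p\<in>points X. \<sigma> p \<in> nbhd L (\<sigma> x)}),
                         cocycle = (\<lambda>x y p. cnj (cocycle L (\<sigma> x) (\<sigma> y) (\<sigma> p)))\<rparr>"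


section \<open>Complete linear systems\<close>

text \<open>Sections are extended by 0 outside the trivialising sets, so that equal sections are equal as
  functions.\<close>
definition global_sections :: "'a surface \<Rightarrow> 'a line_bundle \<Rightarrow> ('a \<Rightarrow> 'a \<Rightarrow> complex) set" where
  "global_sections X L = {s.
     (\<forall>x\<in>points X. holo_on X (nbhd L x) (s x)) \<and>
     (\<forall>x\<in>points X. \<forall>y\<in>points X. \<forall>p\<in>nbhd L x \<inter> nbhd L y. s x p = cocycle L x y p * s y p) \<and>
     (\<forall>x p. x \<notin> points X \<or> p \<notin> nbhd L x \<longrightarrow> s x p = 0)}"

text \<open>The vector space dimension of the space of sections; the complete linear system \<open>|L|\<close> is its
  projectivisation.\<close>
definition h0 :: "'a surface \<Rightarrow> 'a line_bundle \<Rightarrow> nat" where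
  "h0 X L = vector_space.dim (\<lambda>c s x p. c * s x p) (global_sections X L)"

definition zero_set :: "'a surface \<Rightarrow> ('a \<Rightarrow> 'a \<Rightarrow> complex) \<Rightarrow> 'a set" where
  "zero_set X s = {p\<in>points X. s p p = 0}"

text \<open>Singular points and nodes of the zero divisor of \<open>s\<close>, read off from the local equation
  \<open>s p\<close> near \<open>p\<close>: vanishing differential, respectively also nondegenerate Hessian.\<close>
definition singular_points :: "'a surface \<Rightarrow> ('a \<Rightarrow> 'a \<Rightarrow> complex) \<Rightarrow> 'a set" where
  "singular_points X s = {p\<in>zero_set X s. \<forall>(U, \<phi>)\<in>atlas X. p \<in> U \<longrightarrow>
     (let F = s p \<circ> inv_into U \<phi> in pd1 F (\<phi> p) = 0 \<and> pd2 F (\<phi> p) = 0)}"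

definition nodes :: "'a surface \<Rightarrow> ('a \<Rightarrow> 'a \<Rightarrow> complex) \<Rightarrow> 'a set" where
  "nodes X s = {p\<in>singular_points X s. \<forall>(U, \<phi>)\<in>atlas X. p \<in> U \<longrightarrow>
     (let F = s p \<circ> inv_into U \<phi> in
        pd1 (pd1 F) (\<phi> p) * pd2 (pd2 F) (\<phi> p) \<noteq> (pd1 (pd2 F) (\<phi> p))\<^sup>2)}"

text \<open>Reduced means that only finitely many points have vanishing differential (a multiple component
  would consist of such points); a reduced curve is irreducible iff its smooth locus is connected.\<close>
definition integral_divisor :: "'a surface \<Rightarrow> ('a \<Rightarrow> 'a \<Rightarrow> complex) \<Rightarrow> bool" where
  "integral_divisor X s \<longleftrightarrow> zero_set X s \<noteq> {} \<and> finite (singular_points X s) \<and>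
     connectedin (top_of X) (zero_set X s - singular_points X s)"

definition smooth_divisor :: "'a surface \<Rightarrow> ('a \<Rightarrow> 'a \<Rightarrow> complex) \<Rightarrow> bool" where
  "smooth_divisor X s \<longleftrightarrow> zero_set X s \<noteq> {} \<and> singular_points X s = {}"

text \<open>The genus of the members of a linear system is the genus of its smooth members; a smooth
  projective curve has genus \<open>g\<close> iff it is connected with first Betti number \<open>2 g\<close>.\<close>
definition system_of_genus :: "'a surface \<Rightarrow> 'a line_bundle \<Rightarrow> nat \<Rightarrow> bool" where
  "system_of_genus X L g \<longleftrightarrow>
     (\<exists>s\<in>global_sections X L. smooth_divisor X s) \<and>
     (\<forall>s\<in>global_sections X L. smooth_divisor X s \<longrightarrow>
        connectedin (top_of X) (zero_set X s) \<and>
        betti 1 (subtopology (top_of X) (zero_set X s)) = enat (2 * g))"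

text \<open>The normalisation of the curve is the projective line: \<open>f\<close> and \<open>h\<close> are the restrictions of a
  holomorphic, generically injective map to the two standard affine charts.\<close>
definition rational_curve :: "'a surface \<Rightarrow> 'a set \<Rightarrow> bool" where
  "rational_curve X C \<longleftrightarrow> (\<exists>f h :: complex \<Rightarrow> 'a.
     (\<forall>n\<in>{f, h}. continuous_map euclidean (top_of X) n \<and>
        (\<forall>W u. holo_on X W u \<longrightarrow> (u \<circ> n) holomorphic_on (n -` W))) \<and>
     (\<forall>z. z \<noteq> 0 \<longrightarrow> f z = h (1 / z)) \<and>
     C = range f \<union> {h 0} \<and>
     (\<exists>E. finite E \<and> inj_on f (UNIV - E)))"

text \<open>An integral member of \<open>|L|\<close> is determined by its support, so curves are counted as sets.\<close>
definition rational_curves :: "'a surface \<Rightarrow> 'a line_bundle \<Rightarrow> 'a set set" where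
  "rational_curves X L =
     {C. rational_curve X C \<and> (\<exists>s\<in>global_sections X L. integral_divisor X s \<and> C = zero_set X s)}"

definition real_rational_curves :: "'a surface \<Rightarrow> ('a \<Rightarrow> 'a) \<Rightarrow> 'a line_bundle \<Rightarrow> 'a set set" where
  "real_rational_curves X \<sigma> L = {C\<in>rational_curves X L. \<sigma> ` C = C}"

text \<open>A real node is solitary (two complex conjugate branches) iff it is isolated among the real
  points of the curve.\<close>
definition solitary_points :: "'a surface \<Rightarrow> ('a \<Rightarrow> 'a) \<Rightarrow> 'a line_bundle \<Rightarrow> 'a set \<Rightarrow> 'a set" where
  "solitary_points X \<sigma> L C = {p\<in>C \<inter> real_part X \<sigma>.
     (\<exists>s\<in>global_sections X L. integral_divisor X s \<and> C = zero_set X s \<and> p \<in> nodes X s) \<and>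
     (\<exists>W. openin (top_of X) W \<and> W \<inter> C \<inter> real_part X \<sigma> = {p})}"

definition n_plus :: "'a surface \<Rightarrow> ('a \<Rightarrow> 'a) \<Rightarrow> 'a line_bundle \<Rightarrow> nat" where
  "n_plus X \<sigma> L = card {C\<in>real_rational_curves X \<sigma> L. even (card (solitary_points X \<sigma> L C))}"

definition n_minus :: "'a surface \<Rightarrow> ('a \<Rightarrow> 'a) \<Rightarrow> 'a line_bundle \<Rightarrow> nat" where
  "n_minus X \<sigma> L = card {C\<in>real_rational_curves X \<sigma> L. odd (card (solitary_points X \<sigma> L C))}"

definition welschinger_count :: "'a surface \<Rightarrow> ('a \<Rightarrow> 'a) \<Rightarrow> 'a line_bundle \<Rightarrow> int" where
  "welschinger_count X \<sigma> L = int (n_plus X \<sigma> L) - int (n_minus X \<sigma> L)"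

definition real_count :: "'a surface \<Rightarrow> ('a \<Rightarrow> 'a) \<Rightarrow> 'a line_bundle \<Rightarrow> nat" where
  "real_count X \<sigma> L = card (real_rational_curves X \<sigma> L)"

definition complex_count :: "'a surface \<Rightarrow> 'a line_bundle \<Rightarrow> nat" where
  "complex_count X L = card (rational_curves X L)"


section \<open>Generic polarised real K3 surfaces\<close>

text \<open>For \<open>g \<ge> 2\<close>, Picard rank 1 and primitivity make \<open>L\<close> an ample generator of the Picard group (its
  degree is \<open>2 g - 2 > 0\<close> and it is effective), and all members of \<open>|L|\<close> are integral. For
  \<open>g \<le> 1\<close> the Picard rank is not restricted and integrality of the members is a genericity
  condition.\<close>
definition generic_real_K3 :: "'a surface \<Rightarrow> ('a \<Rightarrow> 'a) \<Rightarrow> 'a line_bundle \<Rightarrow> nat \<Rightarrow> bool" where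
  "generic_real_K3 X \<sigma> L g \<longleftrightarrow>
     K3_surface X \<and> real_structure X \<sigma> \<and>
     holo_line_bundle X L \<and> (conj_bundle X \<sigma> L, L) \<in> bundle_iso X \<and>
     h0 X L = g + 1 \<and> system_of_genus X L g \<and>
     (g \<ge> 2 \<longrightarrow> picard_rank X = 1 \<and> primitive_in (Pic X) (bundle_iso X `` {L})) \<and>
     (g \<le> 1 \<longrightarrow> (\<forall>s\<in>global_sections X L. s \<noteq> (\<lambda>x p. 0) \<longrightarrow> integral_divisor X s)) \<and>
     (\<forall>s\<in>global_sections X L. integral_divisor X s \<and> rational_curve X (zero_set X s) \<longrightarrow>
        singular_points X s \<subseteq> nodes X s)"


section \<open>The generating series\<close>

text \<open>The infinite products converge in the \<open>q\<close>-adic topology; the indices \<open>r, s\<close> are shifted by 1.\<close>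

definition e_C :: int where
  "e_C = 24"

definition complex_series :: "real fps" where
  "complex_series = prodinf (\<lambda>s. 1 / (1 - fps_X ^ Suc s) powi e_C)"

definition welschinger_series :: "int \<Rightarrow> real fps" where
  "welschinger_series e_R =
     prodinf (\<lambda>r. 1 / (1 + fps_X ^ Suc r) powi e_R) *
     prodinf (\<lambda>s. 1 / (1 - fps_X ^ (2 * Suc s)) powi ((e_C - e_R) div 2))"

definition \<psi> :: "nat \<Rightarrow> real" where
  "\<psi> g = fps_nth complex_series g"

definition \<phi> :: "int \<Rightarrow> nat \<Rightarrow> real" where
  "\<phi> e_R g = \<bar>fps_nth (welschinger_series e_R) g\<bar>"

definition \<rho> :: "int \<Rightarrow> real" where
  "\<rho> e_R = (if e_R > 0 then 1 / 2 else sqrt (real_of_int (e_C - 3 * e_R) / real_of_int (4 * e_C)))"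

end

theory Submission
  imports Defs "HOL-Real_Asymp.Real_Asymp"
begin

text \<open>
  The inequalities between the counts are elementary: every coefficient of the complex series is
  positive, so there are finitely many rational curves; the real ones form a subset, and the
  Welschinger count is a signed count of that subset.

  The asymptotics come from a Tauberian principle for a positive nondecreasing sequence \<open>c\<close>: if
  \<open>F(t) = \<Sum>c\<^sub>n e\<^bsup>-nt\<^esup>\<close> satisfies \<open>ln F(t) \<sim> C/t\<close> as \<open>t \<rightarrow> 0+\<close>, then
  \<open>ln c\<^sub>n = 2 \<surd>(Cn) + o(\<surd>n)\<close> (\<open>log_coeff_asymptotics\<close>). Since all terms are positive,
  \<open>c\<^sub>n \<le> F(t) e\<^bsup>nt\<^esup>\<close>, and \<open>t = \<surd>(C/n)\<close> gives the upper bound. For the lower bound, the mass of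
  \<open>F(t)\<close> sits at the indices \<open>k\<close> close to \<open>C/t\<^sup>2\<close>, and monotonicity bounds all these terms by
  one coefficient just to the right of them.

  The behaviour of the generating functions follows from the Lambert series
  \<open>\<Lambda>(z) = \<Sum>\<^sub>j z\<^sup>j / (j (1 - z\<^sup>j)) = - \<Sum>\<^sub>r ln (1 - z\<^sup>r)\<close>, for which Tannery's theorem gives
  \<open>t \<Lambda>(e\<^bsup>-t\<^esup>) \<rightarrow> \<pi>\<^sup>2/6\<close> and \<open>t \<Lambda>(-e\<^bsup>-t\<^esup>) \<rightarrow> \<pi>\<^sup>2/24\<close>. As \<open>1 + z\<^sup>r = (1 - z\<^bsup>2r\<^esup>) / (1 - z\<^sup>r)\<close>, the complex
  series has the value \<open>exp (24 \<Lambda>(z))\<close> and the Welschinger series with parameter \<open>e\<close> has the value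
  \<open>exp (e (\<Lambda>(z\<^sup>2) - \<Lambda>(z)) + (24 - e)/2 \<Lambda>(z\<^sup>2))\<close>. That the formal infinite products may be evaluated
  in this way is proved by dominating each factor coefficientwise by a power of \<open>1 / (1 - X\<^sup>r)\<close>
  (\<open>evaluates_prodinf\<close>).

  It remains to make the coefficients positive and nondecreasing. A series has nondecreasing
  coefficients if its product with \<open>1 - X\<close> has nonnegative ones, and
  \<open>(1 + X) / (1 - X\<^sup>2) = 1 / (1 - X)\<close>. For \<open>e < 0\<close> the Welschinger product visibly contains the
  factors \<open>1 + X\<close> and \<open>1 / (1 - X\<^sup>2)\<close> among factors with nonnegative coefficients. For \<open>e > 0\<close> the
  same is true after the substitution \<open>X \<mapsto> -X\<close>, by Euler's identity between partitions into odd
  parts and into distinct parts; so the coefficients alternate in sign and the relevant values are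
  those at \<open>z = -e\<^bsup>-t\<^esup>\<close>, where the contributions of \<open>e\<close> cancel in the limit. For \<open>e = 0\<close> only
  \<open>X\<^sup>2\<close> occurs, and the even coefficients have the monotonicity.\<close>

unbundle no vec_syntax
unbundle fps_syntax

section \<open>A Tauberian theorem for nondecreasing coefficients\<close>

text \<open>A single term of a series with nonnegative terms is at most its sum.\<close>
lemma coeff_le_of_sums:
  fixes c :: "nat \<Rightarrow> real"
  assumes "\<And>n. 0 \<le> c n" and "(\<lambda>n. c n * exp (- (real n * t))) sums S"
  shows "c n \<le> S * exp (real n * t)"
proof -
  have "(\<Sum>k\<in>{n}. c k * exp (- (real k * t))) \<le> S"
    using sum_le_suminf[OF sums_summable[OF assms(2)], of "{n}"] sums_unique[OF assms(2)] assms(1)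
    by simp
  then have "c n * exp (- (real n * t)) * exp (real n * t) \<le> S * exp (real n * t)"
    by (intro mult_right_mono) auto
  then show ?thesis
    by (simp add: mult.assoc flip: exp_add)
qed

text \<open>The sum is split at \<open>m\<close> and \<open>n\<close>. Below \<open>m\<close> the exponential weight is traded for the steeper one
  with parameter \<open>t + d\<close>, from \<open>n\<close> on for the flatter one with parameter \<open>t - d\<close>; between \<open>m\<close> and \<open>n\<close>
  every coefficient is at most \<open>c n\<close> and every weight at most \<open>e\<^bsup>-mt\<^esup>\<close>.\<close>
lemma mono_coeff_central_term:
  fixes c :: "nat \<Rightarrow> real"
  assumes nonneg: "\<And>n. 0 \<le> c n" and "mono c"
    and S: "(\<lambda>n. c n * exp (- (real n * t))) sums S"
    and S1: "(\<lambda>n. c n * exp (- (real n * (t + d)))) sums S1"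
    and S2: "(\<lambda>n. c n * exp (- (real n * (t - d)))) sums S2"
    and "0 < t" "0 < d"
  shows "S \<le> exp (m * d) * S1 + exp (- (real n * d)) * S2 + real n * c n * exp (- (m * t))"
proof -
  define h where "h = (\<lambda>k. if k \<in> {..<n} then c n * exp (- (m * t)) else 0)"
  have "h sums (\<Sum>k<n. c n * exp (- (m * t)))"
    unfolding h_def by (rule sums_If_finite_set) auto
  then have h: "h sums (real n * c n * exp (- (m * t)))"
    by (simp add: mult.assoc)
  have hnn: "0 \<le> h k" for k using nonneg by (simp add: h_def)
  have "c k * exp (- (real k * t)) \<le> exp (m * d) * (c k * exp (- (real k * (t + d))))
           + exp (- (real n * d)) * (c k * exp (- (real k * (t - d)))) + h k" for k
  proof -
    have pos: "0 \<le> exp (m * d) * (c k * exp (- (real k * (t + d))))"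
              "0 \<le> exp (- (real n * d)) * (c k * exp (- (real k * (t - d))))"
      using nonneg by auto
    consider "real k \<le> m" | "n \<le> k" | "m < real k" "k < n" by linarith
    then show ?thesis
    proof cases
      case 1
      then have "real k * d \<le> m * d" using \<open>0 < d\<close> by (intro mult_right_mono) auto
      then have "exp (- (real k * t)) \<le> exp (m * d) * exp (- (real k * (t + d)))"
        by (simp add: algebra_simps flip: exp_add)
      then have "c k * exp (- (real k * t)) \<le> exp (m * d) * (c k * exp (- (real k * (t + d))))"
        using mult_left_mono[OF _ nonneg[of k]] by (metis mult.left_commute)
      then show ?thesis using pos hnn[of k] by linarith
    next
      case 2
      then have "real n * d \<le> real k * d" using \<open>0 < d\<close> by (intro mult_right_mono) auto
      then have "exp (- (real k * t)) \<le> exp (- (real n * d)) * exp (- (real k * (t - d)))"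
        by (simp add: algebra_simps flip: exp_add)
      then have "c k * exp (- (real k * t)) \<le> exp (- (real n * d)) * (c k * exp (- (real k * (t - d))))"
        using mult_left_mono[OF _ nonneg[of k]] by (metis mult.left_commute)
      then show ?thesis using pos hnn[of k] by linarith
    next
      case 3
      have "c k \<le> c n" using \<open>mono c\<close> 3(2) by (auto simp: mono_def)
      moreover have "exp (- (real k * t)) \<le> exp (- (m * t))"
        using 3(1) \<open>0 < t\<close> by simp
      ultimately have "c k * exp (- (real k * t)) \<le> c n * exp (- (m * t))"
        using nonneg by (intro mult_mono) auto
      then show ?thesis using pos 3(2) by (simp add: h_def)
    qed
  qed
  then show ?thesis
    by (rule sums_le[OF _ S sums_add[OF sums_add[OF sums_mult[OF S1] sums_mult[OF S2]] h]])
qed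

text \<open>The bound \<open>ln (c n) \<le> nt + ln (F t)\<close>, where \<open>ln (F t)\<close> is close to \<open>C / t\<close>, is best at the
  minimum \<open>t = sqrt (C / n)\<close> of \<open>nt + C / t\<close>.\<close>
lemma log_coeff_upper:
  fixes c :: "nat \<Rightarrow> real" and F :: "real \<Rightarrow> real"
  assumes pos: "\<And>n. 0 < c n"
    and F: "\<And>t. 0 < t \<Longrightarrow> (\<lambda>n. c n * exp (- (real n * t))) sums F t"
    and lim: "((\<lambda>t. t * ln (F t)) \<longlongrightarrow> C) (at_right 0)" and "0 < C" and "0 < \<epsilon>"
  shows "eventually (\<lambda>n. ln (c n) \<le> (2 + \<epsilon>) * sqrt (C * real n)) sequentially"
proof -
  define t where "t = (\<lambda>n::nat. sqrt (C / real n))"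
  have "filterlim t (at_right 0) sequentially"
    unfolding t_def using \<open>0 < C\<close> by real_asymp
  then have "((\<lambda>n. t n * ln (F (t n))) \<longlongrightarrow> C) sequentially"
    by (rule filterlim_compose[OF lim])
  then have "eventually (\<lambda>n. t n * ln (F (t n)) < C * (1 + \<epsilon>)) sequentially"
    by (rule order_tendstoD(2)) (use assms in \<open>auto simp: algebra_simps\<close>)
  then show ?thesis
    using eventually_gt_at_top[of 0]
  proof eventually_elim
    case (elim n)
    define u where "u = sqrt (C * real n)"
    have tpos: "0 < t n" and upos: "0 < u" using elim \<open>0 < C\<close> by (auto simp: t_def u_def)
    have ut: "u * t n = C" "real n * t n = u"
      using elim \<open>0 < C\<close>
      by (auto simp: u_def t_def real_sqrt_divide real_sqrt_mult field_simps)
    have c: "c n \<le> F (t n) * exp (real n * t n)"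
      by (rule coeff_le_of_sums[OF _ F[OF tpos]]) (use pos less_imp_le in blast)
    then have "0 < F (t n) * exp (real n * t n)" using pos[of n] by linarith
    then have Fpos: "0 < F (t n)" by (simp add: zero_less_mult_iff)
    have "ln (c n) \<le> ln (F (t n) * exp (real n * t n))"
      using c pos[of n] by (intro ln_mono) auto
    also have "\<dots> = ln (F (t n)) + u"
      using Fpos ut by (subst ln_mult) auto
    also have "ln (F (t n)) \<le> u * (1 + \<epsilon>)"
    proof -
      have "t n * ln (F (t n)) \<le> t n * (u * (1 + \<epsilon>))"
        using elim(1) ut(1) by (simp add: mult.commute[of u] mult.assoc[symmetric]) (simp add: algebra_simps)
      then show ?thesis using tpos by simp
    qed
    finally show ?case by (simp add: u_def algebra_simps)
  qed
qed

text \<open>Put \<open>u = C / t\<close>, so that \<open>ln (F t)\<close> is about \<open>u\<close> and the largest terms of \<open>F t\<close> have index about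
  \<open>C / t\<^sup>2\<close>. The sum is split at \<open>m = (1 - 2\<delta>) C / t\<^sup>2\<close> and \<open>n = (1 + 2\<delta>) C / t\<^sup>2\<close>, with slopes
  \<open>(1 \<plusminus> \<delta>) t\<close>. The exponents of the two outer parts then fall short of that of \<open>F t\<close> by a
  multiple of \<open>u \<delta>\<^sup>2\<close>, hence the middle part carries at least half of \<open>F t\<close>.\<close>
lemma log_coeff_lower:
  fixes c :: "nat \<Rightarrow> real" and F :: "real \<Rightarrow> real"
  assumes pos: "\<And>n. 0 < c n" and "mono c"
    and F: "\<And>t. 0 < t \<Longrightarrow> (\<lambda>n. c n * exp (- (real n * t))) sums F t"
    and lim: "((\<lambda>t. t * ln (F t)) \<longlongrightarrow> C) (at_right 0)" and "0 < C"
    and \<delta>: "0 < \<delta>" "\<delta> \<le> 1 / 4"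
  shows "eventually (\<lambda>n. (2 - 6 * \<delta>) * sqrt (C * real n) \<le> ln (c n)) sequentially"
proof -
  have Fpos: "0 < F t" if "0 < t" for t
  proof -
    have "c 0 \<le> F t * exp (real 0 * t)"
      by (rule coeff_le_of_sums[OF _ F[OF that]]) (use pos less_imp_le in blast)
    then show ?thesis using pos[of 0] by simp
  qed
  \<comment> \<open>The relative precision to which \<open>t * ln (F t)\<close> is needed: small against the gain of order \<open>\<delta>\<^sup>2\<close>.\<close>
  define q where "q = \<delta>\<^sup>2 / 8"
  have q: "0 < q" "q \<le> \<delta>" using \<delta> by (auto simp: q_def power2_eq_square)
  \<comment> \<open>Chosen so that \<open>n = (1 + 2 * \<delta>) * C / t\<^sup>2\<close>.\<close>
  define t where "t = (\<lambda>n::nat. sqrt ((1 + 2 * \<delta>) * C / real n))"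
  have near: "eventually (\<lambda>s. \<bar>s * ln (F s) - C\<bar> < C * q) (at_right 0)"
    using tendstoD[OF lim, of "C * q"] q \<open>0 < C\<close> by (simp add: dist_real_def)
  have flt: "filterlim (\<lambda>n. a * t n) (at_right 0) sequentially" if "0 < a" for a
    unfolding t_def using \<open>0 < C\<close> \<delta> that by real_asymp
  have near': "eventually (\<lambda>n. \<bar>a * t n * ln (F (a * t n)) - C\<bar> < C * q) sequentially" if "0 < a" for a
    using eventually_compose_filterlim[OF near flt[OF that]] .
  have big_u: "eventually (\<lambda>n. ln 4 \<le> q * (C / t n)) sequentially"
    unfolding t_def using \<open>0 < C\<close> \<delta> q by real_asymp
  have small_log: "eventually (\<lambda>n. ln (real n) + ln 2 \<le> \<delta> * sqrt (C * real n)) sequentially"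
    using \<open>0 < C\<close> \<delta> by real_asymp
  have "0 < 1 + \<delta>" "0 < 1 - \<delta>" using \<delta> by auto
  show ?thesis
    using near'[OF zero_less_one] near'[OF \<open>0 < 1 + \<delta>\<close>] near'[OF \<open>0 < 1 - \<delta>\<close>]
      big_u small_log eventually_gt_at_top[of 0]
  proof eventually_elim
    case (elim n)
    have e1: "\<bar>t n * ln (F (t n)) - C\<bar> < C * q"
      and e2: "\<bar>(1 + \<delta>) * t n * ln (F ((1 + \<delta>) * t n)) - C\<bar> < C * q"
      and e3: "\<bar>(1 - \<delta>) * t n * ln (F ((1 - \<delta>) * t n)) - C\<bar> < C * q"
      using elim \<delta> by auto
    define T where "T = t n"
    define u where "u = C / T"
    define v where "v = sqrt (C * real n)"
    have Tpos: "0 < T" using elim(6) \<open>0 < C\<close> \<delta> by (simp add: T_def t_def)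
    have upos: "0 < u" using Tpos \<open>0 < C\<close> by (simp add: u_def)
    have C: "C = u * T" using Tpos by (simp add: u_def)
    have T2: "T\<^sup>2 = (1 + 2 * \<delta>) * C / real n"
      using \<open>0 < C\<close> \<delta> by (simp add: T_def t_def)
    have nT: "real n * T = (1 + 2 * \<delta>) * u"
      using T2 elim(6) Tpos by (simp add: u_def power2_eq_square field_simps)
    \<comment> \<open>As \<open>u = v / sqrt (1 + 2 * \<delta>)\<close>, replacing \<open>u\<close> by \<open>v\<close> costs at most the factor \<open>1 - \<delta>\<close>.\<close>
    have uv: "(1 - \<delta>) * v \<le> u"
    proof (rule power2_le_imp_le)
      have "(1 + 2 * \<delta>) * u\<^sup>2 = real n * C"
      proof -
        have "(1 + 2 * \<delta>) * u\<^sup>2 = u * ((1 + 2 * \<delta>) * u)" by (simp add: power2_eq_square)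
        also have "\<dots> = u * (real n * T)" by (simp only: nT)
        also have "\<dots> = real n * C" by (simp add: C)
        finally show ?thesis .
      qed
      moreover have "(1 - \<delta>)\<^sup>2 * (1 + 2 * \<delta>) \<le> 1"
      proof -
        have "(1 - \<delta>)\<^sup>2 * (1 + 2 * \<delta>) = 1 - \<delta>\<^sup>2 * (3 - 2 * \<delta>)"
          by (simp add: power2_eq_square algebra_simps)
        then show ?thesis using \<delta> by simp
      qed
      ultimately have "(1 + 2 * \<delta>) * ((1 - \<delta>)\<^sup>2 * (real n * C)) \<le> (1 + 2 * \<delta>) * u\<^sup>2"
        using \<open>0 < C\<close> mult_right_mono[of "(1 - \<delta>)\<^sup>2 * (1 + 2 * \<delta>)" 1 "real n * C"]
        by (simp add: mult_ac)
      then show "((1 - \<delta>) * v)\<^sup>2 \<le> u\<^sup>2"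
        using \<delta> \<open>0 < C\<close> by (simp add: v_def power_mult_distrib mult.commute)
    qed (use upos in auto)

    have ge: "exp (u * (1 - q)) \<le> F T"
    proof -
      have "T * (u * (1 - q)) \<le> T * ln (F T)"
        using e1 by (simp add: T_def[symmetric] C abs_less_iff algebra_simps)
      then have "u * (1 - q) \<le> ln (F T)" using Tpos by simp
      then show ?thesis using Fpos[OF Tpos] by (simp add: ln_ge_iff)
    qed
    have le: "F (a * T) \<le> exp (u * (1 + q) / a)"
      if "0 < a" "\<bar>a * T * ln (F (a * T)) - C\<bar> < C * q" for a
    proof -
      have "(a * T) * ln (F (a * T)) \<le> u * T * (1 + q)"
        using that(2) by (simp add: C abs_less_iff algebra_simps)
      also have "u * T * (1 + q) = (a * T) * (u * (1 + q) / a)"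
        using that(1) by simp
      finally have "(a * T) * ln (F (a * T)) \<le> (a * T) * (u * (1 + q) / a)" .
      then have "ln (F (a * T)) \<le> u * (1 + q) / a"
        using Tpos that(1) by (simp only: mult_le_cancel_left_pos mult_pos_pos)
      then show ?thesis using Fpos[of "a * T"] Tpos that(1)
        by (metis exp_le_cancel_iff exp_ln mult_pos_pos)
    qed
    have "F (T + \<delta> * T) \<le> exp (u * (1 + q) / (1 + \<delta>))"
      using le[of "1 + \<delta>"] e2 \<delta> by (simp add: T_def[symmetric] algebra_simps)
    then have "exp ((1 - 2 * \<delta>) * u / T * (\<delta> * T)) * F (T + \<delta> * T)
            \<le> exp ((1 - 2 * \<delta>) * u / T * (\<delta> * T)) * exp (u * (1 + q) / (1 + \<delta>))"
      by (intro mult_left_mono) auto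
    also have "\<dots> = exp (u * ((1 - 2 * \<delta>) * \<delta> + (1 + q) / (1 + \<delta>)))"
    proof -
      have "x / T * (\<delta> * T) = x * \<delta>" for x using Tpos by simp
      then have "(1 - 2 * \<delta>) * u / T * (\<delta> * T) = u * ((1 - 2 * \<delta>) * \<delta>)"
        by (simp only: mult_ac)
      then show ?thesis by (simp only: exp_add[symmetric] distrib_left times_divide_eq_right)
    qed
    also have "\<dots> \<le> exp (u * (1 - 2 * q))"
    proof -
      have "(1 - 2 * \<delta>) * \<delta> + (1 + q) / (1 + \<delta>) \<le> 1 - 2 * q"
      proof -
        have "1 + q \<le> (1 - 2 * q - (1 - 2 * \<delta>) * \<delta>) * (1 + \<delta>)"
        proof -
          have "(1 - 2 * q - (1 - 2 * \<delta>) * \<delta>) * (1 + \<delta>) - (1 + q)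
              = \<delta>\<^sup>2 * (5 / 8 + 7 / 4 * \<delta>)"
            by (simp add: q_def power2_eq_square algebra_simps)
          moreover have "0 \<le> \<delta>\<^sup>2 * (5 / 8 + 7 / 4 * \<delta>)" using \<delta> by simp
          ultimately show ?thesis by linarith
        qed
        then have "(1 + q) / (1 + \<delta>) \<le> 1 - 2 * q - (1 - 2 * \<delta>) * \<delta>"
          using \<delta> by (simp add: pos_divide_le_eq)
        then show ?thesis by simp
      qed
      then show ?thesis using upos by simp
    qed
    finally have head: "exp ((1 - 2 * \<delta>) * u / T * (\<delta> * T)) * F (T + \<delta> * T) \<le> exp (u * (1 - 2 * q))" .
    have "F (T - \<delta> * T) \<le> exp (u * (1 + q) / (1 - \<delta>))"
      using le[of "1 - \<delta>"] e3 \<delta> by (simp add: T_def[symmetric] algebra_simps)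
    then have "exp (- (real n * (\<delta> * T))) * F (T - \<delta> * T)
            \<le> exp (- (real n * (\<delta> * T))) * exp (u * (1 + q) / (1 - \<delta>))"
      by (intro mult_left_mono) auto
    also have nd: "real n * (\<delta> * T) = \<delta> * ((1 + 2 * \<delta>) * u)"
      unfolding nT[symmetric] by simp
    also have "exp (- (\<delta> * ((1 + 2 * \<delta>) * u))) * exp (u * (1 + q) / (1 - \<delta>))
              = exp (u * ((1 + q) / (1 - \<delta>) - (1 + 2 * \<delta>) * \<delta>))"
      by (simp add: algebra_simps flip: exp_add)
    also have "\<dots> \<le> exp (u * (1 - 2 * q))"
    proof -
      have "1 + q \<le> (1 - 2 * q + (1 + 2 * \<delta>) * \<delta>) * (1 - \<delta>)"
      proof -
        have "(1 - 2 * q + (1 + 2 * \<delta>) * \<delta>) * (1 - \<delta>) - (1 + q) = \<delta>\<^sup>2 * (5 / 8 - 7 / 4 * \<delta>)"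
          by (simp add: q_def power2_eq_square field_simps)
        moreover have "0 \<le> \<delta>\<^sup>2 * (5 / 8 - 7 / 4 * \<delta>)" using \<delta> by simp
        ultimately show ?thesis by linarith
      qed
      then have "(1 + q) / (1 - \<delta>) \<le> 1 - 2 * q + (1 + 2 * \<delta>) * \<delta>"
        using \<delta> by (simp add: pos_divide_le_eq)
      then show ?thesis using upos by simp
    qed
    finally have tail: "exp (- (real n * (\<delta> * T))) * F (T - \<delta> * T) \<le> exp (u * (1 - 2 * q))"
      unfolding nd .
    have dT: "0 < \<delta> * T" "\<delta> * T < T" using \<delta> Tpos by simp_all
    have "F T \<le> exp ((1 - 2 * \<delta>) * u / T * (\<delta> * T)) * F (T + \<delta> * T)
            + exp (- (real n * (\<delta> * T))) * F (T - \<delta> * T)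
            + real n * c n * exp (- ((1 - 2 * \<delta>) * u / T * T))"
      using dT Tpos less_imp_le[OF pos]
      by (intro mono_coeff_central_term[OF _ \<open>mono c\<close>] F) (auto intro: add_pos_pos)
    with ge head tail
    have sum: "exp (u * (1 - q)) \<le> 2 * exp (u * (1 - 2 * q)) + real n * c n * exp (- ((1 - 2 * \<delta>) * u))"
      using Tpos by simp
    \<comment> \<open>For large \<open>n\<close> the two outer parts together are at most half of \<open>exp (u * (1 - q))\<close>.\<close>
    have "4 * exp (u * (1 - 2 * q)) \<le> exp (q * u) * exp (u * (1 - 2 * q))"
    proof -
      have "exp (ln 4) \<le> exp (q * u)"
        using elim(4) by (simp only: exp_le_cancel_iff u_def T_def)
      then show ?thesis by simp
    qed
    also have "\<dots> = exp (u * (1 - q))"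
      by (simp add: algebra_simps flip: exp_add)
    finally have "exp (u * (1 - q)) \<le> 2 * (real n * c n) * exp (- ((1 - 2 * \<delta>) * u))"
      using sum by linarith
    moreover have "x * exp y \<le> z" if "x \<le> z * exp (- y)" for x y z :: real
      using that by (simp add: exp_minus field_simps)
    ultimately have "exp (u * (1 - q)) * exp ((1 - 2 * \<delta>) * u) \<le> 2 * (real n * c n)"
      by blast
    then have "exp (u * (2 - 2 * \<delta> - q)) \<le> 2 * (real n * c n)"
      by (simp add: algebra_simps flip: exp_add)
    then have "u * (2 - 2 * \<delta> - q) \<le> ln (2 * (real n * c n))"
      using pos[of n] elim(6) by (subst ln_ge_iff) auto
    also have "\<dots> = ln 2 + ln (real n) + ln (c n)"
      using pos[of n] elim(6) by (simp add: ln_mult)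
    finally have "u * (2 - 2 * \<delta> - q) - \<delta> * v \<le> ln (c n)"
      using elim(5) by (simp add: v_def)
    moreover have "(2 - 5 * \<delta>) * v \<le> u * (2 - 2 * \<delta> - q)"
    proof -
      have "0 \<le> v" using \<open>0 < C\<close> by (simp add: v_def)
      then have "(2 - 5 * \<delta>) * v \<le> ((1 - \<delta>) * (2 - 3 * \<delta>)) * v"
        by (intro mult_right_mono) (simp_all add: algebra_simps)
      also have "\<dots> = ((1 - \<delta>) * v) * (2 - 3 * \<delta>)" by simp
      also have "\<dots> \<le> u * (2 - 3 * \<delta>)"
        using uv \<delta> by (intro mult_right_mono) auto
      also have "\<dots> \<le> u * (2 - 2 * \<delta> - q)"
        using upos q by (intro mult_left_mono) auto
      finally show ?thesis .
    qed
    ultimately show ?case by (simp add: v_def algebra_simps)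
  qed
qed

text \<open>The bounds above leave relative errors \<open>\<epsilon>\<close> and \<open>6 \<delta>\<close>, both arbitrarily small.\<close>
theorem log_coeff_asymptotics:
  fixes c :: "nat \<Rightarrow> real" and F :: "real \<Rightarrow> real"
  assumes pos: "\<And>n. 0 < c n" and mono: "mono c"
    and F: "\<And>t. 0 < t \<Longrightarrow> (\<lambda>n. c n * exp (- (real n * t))) sums F t"
    and lim: "((\<lambda>t. t * ln (F t)) \<longlongrightarrow> C) (at_right 0)" and "0 < C"
  shows "(\<lambda>n. ln (c n) - 2 * sqrt C * sqrt (real n)) \<in> o(\<lambda>n. sqrt (real n))"
proof (rule landau_o.smallI)
  fix \<epsilon> :: real assume "0 < \<epsilon>"
  define \<eta> where "\<eta> = \<epsilon> / sqrt C"
  define \<delta> where "\<delta> = min (1 / 4) (\<eta> / 6)"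
  have \<eta>: "0 < \<eta>" "\<eta> * sqrt C = \<epsilon>" using \<open>0 < \<epsilon>\<close> \<open>0 < C\<close> by (auto simp: \<eta>_def)
  have \<delta>: "0 < \<delta>" "\<delta> \<le> 1 / 4" "6 * \<delta> \<le> \<eta>" using \<eta> by (auto simp: \<delta>_def)
  have upper: "eventually (\<lambda>n. ln (c n) \<le> (2 + \<eta>) * sqrt (C * real n)) sequentially"
    by (rule log_coeff_upper[OF pos F lim \<open>0 < C\<close> \<eta>(1)])
  have lower: "eventually (\<lambda>n. (2 - 6 * \<delta>) * sqrt (C * real n) \<le> ln (c n)) sequentially"
    by (rule log_coeff_lower[OF pos mono F lim \<open>0 < C\<close> \<delta>(1,2)])
  show "eventually (\<lambda>n. norm (ln (c n) - 2 * sqrt C * sqrt (real n)) \<le> \<epsilon> * norm (sqrt (real n))) sequentially"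
    using upper lower
  proof eventually_elim
    case (elim n)
    have v: "sqrt (C * real n) = sqrt C * sqrt (real n)" by (simp add: real_sqrt_mult)
    have e: "\<epsilon> * sqrt (real n) = \<eta> * sqrt (C * real n)" using \<eta> by (simp add: v)
    have "6 * \<delta> * sqrt (C * real n) \<le> \<eta> * sqrt (C * real n)"
      using \<delta> \<open>0 < C\<close> by (intro mult_right_mono) auto
    with elim show ?case
      unfolding real_norm_def abs_of_nonneg[OF real_sqrt_ge_zero[OF of_nat_0_le_iff]] e mult.assoc v[symmetric]
      by (simp add: abs_le_iff algebra_simps)
  qed
qed

section \<open>The logarithm of Euler's product\<close>

text \<open>The Lambert series of \<open>1 / j\<close>: minus the logarithm of Euler's product \<open>\<Prod>(1 - z\<^sup>r)\<close>, by
  \<open>lambert_sums\<close>.\<close>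
definition lambert :: "real \<Rightarrow> real" where
  "lambert z = (suminf (\<lambda>j. z ^ Suc j / (real (Suc j) * (1 - z ^ Suc j))))"

lemma minus_ln_one_minus_sums:
  fixes y :: real
  assumes "\<bar>y\<bar> < 1"
  shows "(\<lambda>j. y ^ Suc j / real (Suc j)) sums (- ln (1 - y))"
proof -
  have "(\<lambda>n. - (- (y ^ n) / real n)) sums (- ln (1 - y))"
    using sums_minus[OF ln_series'[of "- y"]] assms by simp
  then have "(\<lambda>n. y ^ n / real n) sums (- ln (1 - y))" by simp
  then show ?thesis by (subst sums_Suc_iff) simp
qed

text \<open>Expanding the logarithms of the first \<open>N\<close> factors and summing the resulting geometric sums over
  the factors gives a series over \<open>j\<close> whose terms converge, as \<open>N\<close> grows, to those of the Lambert
  series; a geometric majorant allows the limit to be taken term by term.\<close>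
lemma lambert_sums:
  assumes "\<bar>z\<bar> < 1"
  shows "(\<lambda>r. - ln (1 - z ^ Suc r)) sums lambert z"
proof -
  define a where "a = (\<lambda>j N. \<Sum>r<N. (z ^ Suc r) ^ Suc j / real (Suc j))"
  have zpow: "\<bar>z ^ Suc k\<bar> < 1" for k
    unfolding power_abs using assms by (simp only: power_less_one_iff abs_ge_zero) simp
  have a_eq: "a j N = z ^ Suc j * (1 - (z ^ Suc j) ^ N) / (real (Suc j) * (1 - z ^ Suc j))" for j N
  proof -
    have ne: "z ^ Suc j \<noteq> 1" using zpow[of j] by auto
    have "a j N = (\<Sum>r<N. z ^ Suc j * (z ^ Suc j) ^ r) / real (Suc j)"
      unfolding a_def by (simp only: power_mult[symmetric] sum_divide_distrib)
        (intro sum.cong refl, simp add: power_mult power_add mult.commute flip: power_mult)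
    also have "(\<Sum>r<N. z ^ Suc j * (z ^ Suc j) ^ r) = z ^ Suc j * ((1 - (z ^ Suc j) ^ N) / (1 - z ^ Suc j))"
      using ne by (simp only: sum_distrib_left[symmetric] sum_gp_strict if_False)
    finally show ?thesis by simp
  qed
  have partial: "(\<Sum>r<N. - ln (1 - z ^ Suc r)) = (suminf (\<lambda>j. a j N))" for N
    unfolding a_def by (rule sums_unique[OF sums_sum[OF minus_ln_one_minus_sums[OF zpow]]])
  have "((\<lambda>N. suminf (\<lambda>j. a j N)) \<longlongrightarrow> (suminf (\<lambda>j. z ^ Suc j * (1 - 0) / (real (Suc j) * (1 - z ^ Suc j))))) sequentially"
  proof (rule tannerys_theorem[THEN conjunct2, THEN conjunct2])
    show "((\<lambda>N. a j N) \<longlongrightarrow> z ^ Suc j * (1 - 0) / (real (Suc j) * (1 - z ^ Suc j))) sequentially" for j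
      unfolding a_eq using zpow[of j] by (intro tendsto_intros LIMSEQ_abs_realpow_zero2) auto
    show "\<forall>\<^sub>F (j, N) in sequentially \<times>\<^sub>F sequentially. norm (a j N) \<le> \<bar>z\<bar> ^ Suc j * (2 / (1 - \<bar>z\<bar>))"
    proof (intro always_eventually allI, clarify)
      fix j N
      have "\<bar>1 - (z ^ Suc j) ^ N\<bar> \<le> 2"
      proof -
        have "\<bar>(z ^ Suc j) ^ N\<bar> \<le> 1" unfolding power_abs[of "z ^ Suc j"] using zpow[of j] by (intro power_le_one) linarith+
        then show ?thesis by linarith
      qed
      moreover have "1 - \<bar>z\<bar> \<le> \<bar>real (Suc j) * (1 - z ^ Suc j)\<bar>"
      proof -
        have "\<bar>z ^ Suc j\<bar> \<le> \<bar>z\<bar>"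
          using assms by (simp add: abs_mult power_abs mult_left_le power_le_one)
        then have "1 - \<bar>z\<bar> \<le> \<bar>1 - z ^ Suc j\<bar>" by linarith
        also have "\<dots> \<le> real (Suc j) * \<bar>1 - z ^ Suc j\<bar>" by (simp add: distrib_right)
        finally show ?thesis by (simp add: abs_mult)
      qed
      ultimately have "\<bar>1 - (z ^ Suc j) ^ N\<bar> / \<bar>real (Suc j) * (1 - z ^ Suc j)\<bar> \<le> 2 / (1 - \<bar>z\<bar>)"
        using assms by (intro frac_le) auto
      then have "\<bar>z ^ Suc j\<bar> * (\<bar>1 - (z ^ Suc j) ^ N\<bar> / \<bar>real (Suc j) * (1 - z ^ Suc j)\<bar>)
               \<le> \<bar>z ^ Suc j\<bar> * (2 / (1 - \<bar>z\<bar>))"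
        by (intro mult_left_mono) auto
      then show "norm (a j N) \<le> \<bar>z\<bar> ^ Suc j * (2 / (1 - \<bar>z\<bar>))"
        unfolding a_eq real_norm_def abs_divide abs_mult[of "z ^ Suc j" "1 - (z ^ Suc j) ^ N"]
        by (simp only: power_abs times_divide_eq_right)
    qed
    show "summable (\<lambda>j. \<bar>z\<bar> ^ Suc j * (2 / (1 - \<bar>z\<bar>)))"
      using assms by (intro summable_mult2) (simp add: summable_Suc_iff summable_geometric del: power_Suc)
  qed simp
  then have "((\<lambda>N. suminf (\<lambda>j. a j N)) \<longlongrightarrow> lambert z) sequentially" by (simp add: lambert_def)
  then show ?thesis unfolding sums_def partial .
qed

text \<open>This is \<open>1 + x \<le> exp x\<close> at \<open>x = a * t\<close>. It makes \<open>1 / j\<^sup>2\<close> a majorant that is uniform in \<open>t\<close>.\<close>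
lemma lambert_term_bound:
  fixes a t :: real
  assumes "0 < a" "0 < t"
  shows "t * exp (- (a * t)) / (a * (1 - exp (- (a * t)))) \<le> 1 / a\<^sup>2"
proof -
  have "1 + a * t \<le> exp (a * t)" by (rule exp_ge_add_one_self)
  then have "a * t * exp (- (a * t)) \<le> 1 - exp (- (a * t))"
    by (simp add: exp_minus field_simps)
  moreover have "0 < 1 - exp (- (a * t))" using assms by simp
  ultimately have "a * t * exp (- (a * t)) / (1 - exp (- (a * t))) / a\<^sup>2 \<le> 1 / a\<^sup>2"
    by (intro divide_right_mono) auto
  also have "a * t * exp (- (a * t)) / (1 - exp (- (a * t))) / a\<^sup>2 = t * exp (- (a * t)) / (a * (1 - exp (- (a * t))))"
    using assms by (simp add: power2_eq_square)
  finally show ?thesis .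
qed

text \<open>Of all \<open>f t\<close> with the same absolute value, the positive one makes the denominators smallest, so
  the majorant for it serves for both signs.\<close>
lemma lambert_limit_by_terms:
  assumes "\<And>j. ((\<lambda>t. t * f t ^ Suc j / (real (Suc j) * (1 - f t ^ Suc j))) \<longlongrightarrow> b j) (at_right 0)"
    and abs_f: "\<And>t. \<bar>f t\<bar> = exp (- t)"
  shows "((\<lambda>t. t * lambert (f t)) \<longlongrightarrow> (suminf b)) (at_right 0)"
proof -
  have bound: "\<bar>t * f t ^ Suc j / (real (Suc j) * (1 - f t ^ Suc j))\<bar> \<le> 1 / (real (Suc j))\<^sup>2"
    if "0 < t" for t j
  proof -
    define a where "a = real (Suc j)"
    have "0 < a" by (simp add: a_def)
    have y: "\<bar>f t ^ Suc j\<bar> = exp (- (a * t))"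
      by (simp only: power_abs abs_f exp_of_nat_mult[symmetric] a_def) simp
    have lt: "exp (- (a * t)) < 1" using \<open>0 < a\<close> that by simp
    have "1 - exp (- (a * t)) \<le> \<bar>1 - f t ^ Suc j\<bar>" using y by linarith
    moreover have "0 < 1 - exp (- (a * t))" "0 < \<bar>1 - f t ^ Suc j\<bar>" using lt y by linarith+
    ultimately have "t * exp (- (a * t)) / (a * \<bar>1 - f t ^ Suc j\<bar>) \<le> t * exp (- (a * t)) / (a * (1 - exp (- (a * t))))"
      using \<open>0 < a\<close> that
      by (intro divide_left_mono mult_left_mono mult_pos_pos mult_nonneg_nonneg; (assumption | simp))
    also have "\<dots> \<le> 1 / a\<^sup>2" by (rule lambert_term_bound) fact+
    finally show ?thesis
      unfolding abs_divide abs_mult y a_def[symmetric] using that \<open>0 < a\<close> by simp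
  qed
  have "((\<lambda>t. suminf (\<lambda>j. t * f t ^ Suc j / (real (Suc j) * (1 - f t ^ Suc j)))) \<longlongrightarrow> (suminf b)) (at_right 0)"
  proof (rule tannerys_theorem[THEN conjunct2, THEN conjunct2])
    have "eventually (\<lambda>x. True \<and> 0 < snd x) (sequentially \<times>\<^sub>F at_right (0::real))"
      by (rule eventually_prodI[where P = "\<lambda>_. True"]) (auto simp: eventually_at_right_less)
    then show "\<forall>\<^sub>F (j, t) in sequentially \<times>\<^sub>F at_right 0.
        norm (t * f t ^ Suc j / (real (Suc j) * (1 - f t ^ Suc j))) \<le> 1 / (real (Suc j))\<^sup>2"
      by eventually_elim (use bound in \<open>auto simp del: power_Suc\<close>)
    show "summable (\<lambda>j. 1 / (real (Suc j))\<^sup>2)"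
      using inverse_squares_sums by (simp add: sums_iff add.commute)
  qed (use assms in simp_all)
  moreover have "(suminf (\<lambda>j. t * f t ^ Suc j / (real (Suc j) * (1 - f t ^ Suc j)))) = t * lambert (f t)" if "0 < t" for t
  proof -
    define g where "g = (\<lambda>j. f t ^ Suc j / (real (Suc j) * (1 - f t ^ Suc j)))"
    have "summable (\<lambda>j. t * g j)"
    proof (rule summable_comparison_test')
      show "summable (\<lambda>j. 1 / (real (Suc j))\<^sup>2)"
        using inverse_squares_sums by (simp add: sums_iff add.commute)
      show "norm (t * g j) \<le> 1 / (real (Suc j))\<^sup>2" if "0 \<le> j" for j
        using bound[OF \<open>0 < t\<close>, of j] by (simp add: g_def)
    qed
    then have "summable g" using that by (simp add: summable_cmult_iff)
    then have "(suminf (\<lambda>j. t * g j)) = t * suminf g" by (rule suminf_mult)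
    then show ?thesis by (simp add: g_def lambert_def)
  qed
  then have "\<forall>\<^sub>F t in at_right 0. (suminf (\<lambda>j. t * f t ^ Suc j / (real (Suc j) * (1 - f t ^ Suc j)))) = t * lambert (f t)"
    by (intro eventually_mono[OF eventually_at_right_less]) 
  ultimately show ?thesis by (rule Lim_transform_eventually)
qed

lemma exp_neg_power: "exp (- t) ^ Suc j = exp (- (real (Suc j) * t))" for t :: real
  by (simp only: exp_of_nat_mult[symmetric]) simp

lemma lambert_limit_plus: "((\<lambda>t. t * lambert (exp (- t))) \<longlongrightarrow> pi\<^sup>2 / 6) (at_right 0)"
proof -
  have "((\<lambda>t. t * lambert (exp (- t))) \<longlongrightarrow> (suminf (\<lambda>j. 1 / (real (Suc j))\<^sup>2))) (at_right 0)"
  proof (rule lambert_limit_by_terms)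
    fix j
    define a where "a = real (Suc j)"
    have "0 < a" by (simp add: a_def)
    then have "((\<lambda>t. t * exp (- (a * t)) / (a * (1 - exp (- (a * t))))) \<longlongrightarrow> 1 / a\<^sup>2) (at_right 0)"
      by (real_asymp simp: power2_eq_square field_simps)
    then show "((\<lambda>t. t * exp (- t) ^ Suc j / (real (Suc j) * (1 - exp (- t) ^ Suc j)))
        \<longlongrightarrow> 1 / (real (Suc j))\<^sup>2) (at_right 0)"
      unfolding exp_neg_power a_def .
  qed simp
  moreover have "(\<lambda>j. 1 / (real (Suc j))\<^sup>2) sums (pi\<^sup>2 / 6)"
    using inverse_squares_sums by (simp add: add.commute)
  ultimately show ?thesis by (simp only: sums_unique[symmetric])
qed

text \<open>Only the terms of even index have a pole at \<open>t = 0\<close>, so the limit is the part of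
  \<open>\<Sum>1 / j\<^sup>2\<close> over even \<open>j\<close>, a quarter of the whole.\<close>
lemma lambert_limit_minus: "((\<lambda>t. t * lambert (- exp (- t))) \<longlongrightarrow> pi\<^sup>2 / 24) (at_right 0)"
proof -
  define b where "b = (\<lambda>j. if even (Suc j) then 1 / (real (Suc j))\<^sup>2 else 0)"
  have "((\<lambda>t. t * lambert (- exp (- t))) \<longlongrightarrow> (suminf b)) (at_right 0)"
  proof (rule lambert_limit_by_terms)
    fix j
    define a where "a = real (Suc j)"
    have "0 < a" by (simp add: a_def)
    show "((\<lambda>t. t * (- exp (- t)) ^ Suc j / (real (Suc j) * (1 - (- exp (- t)) ^ Suc j)))
        \<longlongrightarrow> b j) (at_right 0)"
    proof (cases "even (Suc j)")
      case True
      have "((\<lambda>t. t * exp (- (a * t)) / (a * (1 - exp (- (a * t))))) \<longlongrightarrow> 1 / a\<^sup>2) (at_right 0)"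
        using \<open>0 < a\<close> by (real_asymp simp: power2_eq_square field_simps)
      then show ?thesis
        unfolding power_minus_even[OF True] exp_neg_power a_def b_def using True by simp
    next
      case False
      have "((\<lambda>t. t * - exp (- (a * t)) / (a * (1 - - exp (- (a * t))))) \<longlongrightarrow> 0) (at_right 0)"
        using \<open>0 < a\<close> by real_asymp
      then show ?thesis
        unfolding power_minus_odd[OF False] exp_neg_power a_def b_def using False by simp
    qed
  qed simp
  moreover have "b sums (pi\<^sup>2 / 24)"
  proof -
    have "(\<lambda>i. 1 / 4 * (1 / (real i + 1)\<^sup>2)) sums (1 / 4 * (pi\<^sup>2 / 6))"
      using sums_mult[OF inverse_squares_sums, of "1 / 4"] by (simp add: add.commute)
    also have "(\<lambda>i. 1 / 4 * (1 / (real i + 1)\<^sup>2)) = (\<lambda>i. b (2 * i + 1))"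
      by (auto simp: b_def fun_eq_iff power2_eq_square field_simps)
    finally have "(\<lambda>i. b (2 * i + 1)) sums (pi\<^sup>2 / 24)" by simp
    then show ?thesis
    proof (subst (asm) sums_mono_reindex)
      show "b n = 0" if "n \<notin> range (\<lambda>i. 2 * i + 1)" for n
        using that unfolding b_def by (metis even_Suc oddE rangeI)
    qed (auto simp: strict_mono_def)
  qed
  ultimately show ?thesis by (simp only: sums_unique[symmetric])
qed

lemma lambert_limit_square: "((\<lambda>t. t * lambert (exp (- t) ^ 2)) \<longlongrightarrow> pi\<^sup>2 / 12) (at_right 0)"
proof -
  have "filterlim (\<lambda>t::real. 2 * t) (at_right 0) (at_right 0)" by real_asymp
  then have "((\<lambda>t. 1 / 2 * (2 * t * lambert (exp (- (2 * t))))) \<longlongrightarrow> 1 / 2 * (pi\<^sup>2 / 6)) (at_right 0)"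
    by (intro tendsto_mult_left filterlim_compose[OF lambert_limit_plus])
  moreover have "exp (- (2 * t)) = exp (- t) ^ 2" for t :: real
    by (simp add: power2_eq_square flip: exp_add)
  ultimately show ?thesis by simp
qed

section \<open>Geometric series\<close>

text \<open>The expansion of \<open>1 / (1 - c X\<^sup>k)\<close>, for \<open>k > 0\<close>.\<close>
definition geo :: "real \<Rightarrow> nat \<Rightarrow> real fps" where
  "geo c k = Abs_fps (\<lambda>n. if k dvd n then c ^ (n div k) else 0)"

lemma geo_mult:
  assumes "0 < k"
  shows "geo c k * (1 - fps_const c * fps_X ^ k) = 1"
proof (rule fps_ext)
  fix n
  have "(geo c k * (1 - fps_const c * fps_X ^ k)) $ n = (geo c k - fps_const c * (geo c k * fps_X ^ k)) $ n"
    by (simp add: algebra_simps)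
  also have "\<dots> = geo c k $ n - c * (if n < k then 0 else geo c k $ (n - k))"
    by (simp add: fps_X_power_mult_right_nth)
  also have "\<dots> = (1 :: real fps) $ n"
  proof (cases "n < k")
    case True
    then have "k dvd n \<longleftrightarrow> n = 0" using dvd_imp_le by fastforce
    then show ?thesis using True by (simp add: geo_def)
  next
    case False
    then obtain m where n: "n = m + k" by (metis add.commute le_Suc_ex not_less)
    then show ?thesis using assms by (simp add: geo_def)
  qed
  finally show "(geo c k * (1 - fps_const c * fps_X ^ k)) $ n = (1 :: real fps) $ n" .
qed

lemma inverse_eq_geo: "0 < k \<Longrightarrow> inverse (1 - fps_const c * fps_X ^ k) = geo c k"
  using geo_mult[of k c] by (intro fps_inverse_unique) (simp add: mult.commute)

lemma geo_compose_linear: "0 < k \<Longrightarrow> fps_compose (geo c k) (fps_const a * fps_X) = geo (c * a ^ k) k"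
  by (rule fps_ext) (auto simp: geo_def power_mult_distrib power_mult elim!: dvdE)

section \<open>Coefficientwise domination\<close>

definition dominated :: "real fps \<Rightarrow> real fps \<Rightarrow> bool" where
  "dominated F G \<longleftrightarrow> (\<forall>n. \<bar>F $ n\<bar> \<le> G $ n)"

definition nonneg_coeffs :: "real fps \<Rightarrow> bool" where
  "nonneg_coeffs F \<longleftrightarrow> (\<forall>n. 0 \<le> F $ n)"

lemma nonneg_iff_dominated_self: "nonneg_coeffs F \<longleftrightarrow> dominated F F"
  unfolding nonneg_coeffs_def dominated_def by (metis abs_ge_zero abs_of_nonneg order.refl order.trans)

lemma dominated_mult:
  assumes "dominated F F'" "dominated G G'"
  shows "dominated (F * G) (F' * G')"
  unfolding dominated_def
proof
  fix n
  have "\<bar>(F * G) $ n\<bar> \<le> (\<Sum>i=0..n. \<bar>F $ i * G $ (n - i)\<bar>)"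
    unfolding fps_mult_nth by (rule sum_abs)
  also have "\<dots> \<le> (\<Sum>i=0..n. F' $ i * G' $ (n - i))"
    unfolding abs_mult using assms
    by (intro sum_mono mult_mono) (auto simp: dominated_def intro: order.trans[OF abs_ge_zero])
  finally show "\<bar>(F * G) $ n\<bar> \<le> (F' * G') $ n" by (simp add: fps_mult_nth)
qed

lemma dominated_one: "dominated 1 1"
  by (simp add: dominated_def)

lemma dominated_power: "dominated F G \<Longrightarrow> dominated (F ^ n) (G ^ n)"
  by (induction n) (simp_all add: dominated_one dominated_mult)

lemma dominated_prod: "(\<And>i. i \<in> I \<Longrightarrow> dominated (F i) (G i)) \<Longrightarrow> dominated (prod F I) (prod G I)"
  by (induction I rule: infinite_finite_induct) (simp_all add: dominated_one dominated_mult)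

lemma nonneg_coeffs_mult: "nonneg_coeffs F \<Longrightarrow> nonneg_coeffs G \<Longrightarrow> nonneg_coeffs (F * G)"
  by (simp add: nonneg_iff_dominated_self dominated_mult)

lemma nonneg_coeffs_power: "nonneg_coeffs F \<Longrightarrow> nonneg_coeffs (F ^ n)"
  by (simp add: nonneg_iff_dominated_self dominated_power)

lemma nonneg_coeffs_prod: "(\<And>i. i \<in> I \<Longrightarrow> nonneg_coeffs (F i)) \<Longrightarrow> nonneg_coeffs (prod F I)"
  by (simp add: nonneg_iff_dominated_self dominated_prod)

lemma nonneg_coeffs_geo: "nonneg_coeffs (geo 1 k)"
  by (simp add: nonneg_coeffs_def geo_def)

lemma nonneg_coeffs_one_plus: "nonneg_coeffs (1 + fps_X ^ k)"
  by (simp add: nonneg_coeffs_def fps_X_power_nth)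

lemma dominated_geo: "\<bar>c\<bar> \<le> 1 \<Longrightarrow> dominated (geo c k) (geo 1 k)"
  by (simp add: dominated_def geo_def power_abs power_le_one)

lemma dominated_geo_dvd: "k dvd l \<Longrightarrow> dominated (geo 1 l) (geo 1 k)"
  by (auto simp: dominated_def geo_def dest: dvd_trans)

lemma dominated_one_plus: "0 < k \<Longrightarrow> dominated (1 + fps_X ^ k) (geo 1 k)"
  by (auto simp: dominated_def geo_def fps_X_power_nth)

section \<open>Evaluation of formal power series\<close>

text \<open>Absolute convergence is included so that the notion is closed under products.\<close>
definition evaluates :: "real fps \<Rightarrow> real \<Rightarrow> real \<Rightarrow> bool" where
  "evaluates F z v \<longleftrightarrow> summable (\<lambda>n. \<bar>F $ n * z ^ n\<bar>) \<and> (\<lambda>n. F $ n * z ^ n) sums v"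

lemma evaluates_unique: "evaluates F z v \<Longrightarrow> evaluates F z w \<Longrightarrow> v = w"
  by (auto simp: evaluates_def intro: sums_unique2)

lemma evaluates_mult:
  assumes "evaluates F z v" "evaluates G z w"
  shows "evaluates (F * G) z (v * w)"
proof -
  let ?a = "\<lambda>n. F $ n * z ^ n" and ?b = "\<lambda>n. G $ n * z ^ n"
  have coeff: "(\<Sum>i\<le>n. ?a i * ?b (n - i)) = (F * G) $ n * z ^ n" for n
  proof -
    have "?a i * ?b (n - i) = F $ i * G $ (n - i) * z ^ n" if "i \<le> n" for i
    proof -
      have "z ^ n = z ^ i * z ^ (n - i)" using that by (simp flip: power_add)
      then show ?thesis by simp
    qed
    then show ?thesis
      unfolding fps_mult_nth sum_distrib_right atLeast0AtMost by (intro sum.cong) auto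
  qed
  have a: "summable (\<lambda>n. norm (?a n))" "suminf ?a = v" and b: "summable (\<lambda>n. norm (?b n))" "suminf ?b = w"
    using assms by (simp_all add: evaluates_def sums_iff)
  have "(\<lambda>n. (F * G) $ n * z ^ n) sums (v * w)"
    using Cauchy_product_sums[OF a(1) b(1)] a(2) b(2) by (simp only: coeff)
  moreover have "summable (\<lambda>n. \<bar>(F * G) $ n * z ^ n\<bar>)"
  proof (rule summable_comparison_test')
    show "summable (\<lambda>n. \<Sum>i\<le>n. \<bar>?a i\<bar> * \<bar>?b (n - i)\<bar>)"
      using a(1) b(1) by (intro summable_Cauchy_product) simp_all
    show "norm \<bar>(F * G) $ n * z ^ n\<bar> \<le> (\<Sum>i\<le>n. \<bar>?a i\<bar> * \<bar>?b (n - i)\<bar>)" if "0 \<le> n" for n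
      unfolding coeff[symmetric] real_norm_def abs_idempotent abs_mult[symmetric] by (rule sum_abs)
  qed
  ultimately show ?thesis by (simp add: evaluates_def)
qed

lemma evaluates_one_plus: "evaluates (1 + fps_const c * fps_X ^ k) z (1 + c * z ^ k)"
proof -
  have eq: "(1 + fps_const c * fps_X ^ k) $ n * z ^ n
      = (if n = 0 then 1 else 0) + (if n = k then c * z ^ k else 0)" for n
    by (auto simp: fps_X_power_nth algebra_simps)
  have "(\<lambda>n. (if n = 0 then 1 else 0) + (if n = k then c * z ^ k else 0)) sums (1 + c * z ^ k)"
    using sums_add[OF sums_single[of 0 "\<lambda>_. 1"] sums_single[of k "\<lambda>_. c * z ^ k"]] .
  moreover have "summable (\<lambda>n. \<bar>(if n = 0 then 1 else 0) + (if n = k then c * z ^ k else 0)\<bar>)"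
    by (rule summable_finite[of "{0, k}"]) auto
  ultimately show ?thesis unfolding evaluates_def eq by simp
qed

lemma evaluates_one: "evaluates 1 z 1"
  using evaluates_one_plus[of 0 0 z] by simp

lemma evaluates_power: "evaluates F z v \<Longrightarrow> evaluates (F ^ n) z (v ^ n)"
  by (induction n) (simp_all add: evaluates_one evaluates_mult)

lemma evaluates_prod:
  "(\<And>i. i \<in> I \<Longrightarrow> evaluates (F i) z (v i)) \<Longrightarrow> evaluates (prod F I) z (prod v I)"
  by (induction I rule: infinite_finite_induct) (simp_all add: evaluates_one evaluates_mult)

text \<open>The coefficients are bounded, so the value exists; multiplying by \<open>1 - c X\<^sup>k\<close> identifies it.\<close>
lemma evaluates_geo:
  assumes "\<bar>z\<bar> < 1" "\<bar>c\<bar> \<le> 1" "0 < k"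
  shows "evaluates (geo c k) z (1 / (1 - c * z ^ k))"
proof -
  have s: "summable (\<lambda>n. \<bar>geo c k $ n * z ^ n\<bar>)"
  proof (rule summable_comparison_test')
    show "summable (\<lambda>n. \<bar>z\<bar> ^ n)" using assms by (simp add: summable_geometric)
    show "norm \<bar>geo c k $ n * z ^ n\<bar> \<le> \<bar>z\<bar> ^ n" if "0 \<le> n" for n
      using assms(2) by (auto simp: geo_def abs_mult power_abs intro!: mult_left_le_one_le power_le_one)
  qed
  define v where "v = (suminf (\<lambda>n. geo c k $ n * z ^ n))"
  have v: "evaluates (geo c k) z v"
    unfolding evaluates_def v_def using s summable_rabs_cancel[OF s] by (simp add: summable_sums)
  have "evaluates (1 - fps_const c * fps_X ^ k) z (1 - c * z ^ k)"
    using evaluates_one_plus[of "- c" k z] by (simp flip: fps_const_neg)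
  from evaluates_mult[OF v this] have "evaluates 1 z (v * (1 - c * z ^ k))"
    using assms by (simp add: geo_mult)
  then have "v * (1 - c * z ^ k) = 1" using evaluates_one evaluates_unique by blast
  then have "v = 1 / (1 - c * z ^ k)" by (metis mult_zero_right nonzero_eq_divide_eq zero_neq_one)
  then show ?thesis using v by simp
qed

lemma evaluates_exp_power: "evaluates F z (exp x) \<Longrightarrow> evaluates (F ^ n) z (exp (real n * x))"
  using evaluates_power[of F z "exp x" n] by (simp add: exp_of_nat_mult)

lemma abs_power_less_one: "\<bar>z\<bar> < 1 \<Longrightarrow> 0 < k \<Longrightarrow> \<bar>z ^ k\<bar> < 1" for z :: real
  by (simp add: power_abs power_less_one_iff)

lemma evaluates_geo_one:
  assumes "\<bar>z\<bar> < 1" "0 < k"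
  shows "evaluates (geo 1 k) z (exp (- ln (1 - z ^ k)))"
  using evaluates_geo[of z 1 k] abs_power_less_one[of z k] assms
  by (simp add: exp_minus inverse_eq_divide)

section \<open>Infinite products of formal power series\<close>

definition one_upto :: "nat \<Rightarrow> real fps \<Rightarrow> bool" where
  "one_upto s F \<longleftrightarrow> (\<forall>n\<le>s. F $ n = (1 :: real fps) $ n)"

lemma mult_nth_cong:
  fixes F F' G G' :: "real fps"
  assumes "\<And>i. i \<le> n \<Longrightarrow> F $ i = F' $ i" "\<And>i. i \<le> n \<Longrightarrow> G $ i = G' $ i"
  shows "(F * G) $ n = (F' * G') $ n"
  unfolding fps_mult_nth using assms by (intro sum.cong) auto

lemma one_upto_mult: "one_upto s F \<Longrightarrow> one_upto s G \<Longrightarrow> one_upto s (F * G)"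
  unfolding one_upto_def
  by (metis (no_types, lifting) mult_nth_cong mult_1 order_trans)

lemma one_upto_one: "one_upto s 1"
  by (simp add: one_upto_def)

lemma one_upto_power: "one_upto s F \<Longrightarrow> one_upto s (F ^ n)"
  by (induction n) (simp_all add: one_upto_mult one_upto_one)

lemma one_upto_geo: "s < k \<Longrightarrow> one_upto s (geo c k)"
  by (auto simp: one_upto_def geo_def dest: dvd_imp_le)

lemma one_upto_one_plus: "s < k \<Longrightarrow> one_upto s (1 + fps_X ^ k)"
  by (auto simp: one_upto_def fps_X_power_nth)

text \<open>The factor number \<open>s\<close> does not affect the coefficients up to \<open>s\<close>, so each coefficient of the
  partial products is eventually constant.\<close>
lemma prodinf_nth:
  assumes "\<And>s. one_upto s (f s)" and "n \<le> N"
  shows "prodinf f $ n = (\<Prod>s<N. f s) $ n"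
proof -
  define P where "P = Abs_fps (\<lambda>n. (\<Prod>s<n. f s) $ n)"
  have stable: "(\<Prod>s<N. f s) $ n = P $ n" if "n \<le> N" for n N
    using that
  proof (induction N rule: dec_induct)
    case base
    then show ?case by (simp add: P_def)
  next
    case (step N)
    have "(\<Prod>s<Suc N. f s) $ n = ((\<Prod>s<N. f s) * f N) $ n" by simp
    also have "\<dots> = ((\<Prod>s<N. f s) * 1) $ n"
      using assms(1)[of N] step.hyps by (intro mult_nth_cong) (auto simp: one_upto_def)
    finally show ?case using step.IH by simp
  qed
  have "((\<lambda>n. \<Prod>i\<le>n. f (i + 0)) \<longlongrightarrow> P) sequentially"
  proof (rule tendsto_fpsI)
    fix n
    show "\<forall>\<^sub>F N in sequentially. (\<Prod>i\<le>N. f (i + 0)) $ n = P $ n"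
      using eventually_ge_at_top[of n]
    proof eventually_elim
      case (elim N)
      then show ?case using stable[of n "Suc N"] by (simp only: lessThan_Suc_atMost add_0_right)
    qed
  qed
  moreover have "P \<noteq> 0" using stable[of 0 0] by auto
  ultimately have "f has_prod P" by (simp add: has_prod_def raw_has_prod_def)
  then have "prodinf f = P" by (rule has_prod_unique[symmetric])
  then show ?thesis using stable[OF assms(2)] by simp
qed

text \<open>The coefficients of all partial products are bounded by those of the product of the majorants
  \<open>1 / (1 - X\<^bsup>s+1\<^esup>)\<^sup>K\<close>. That product has nonnegative coefficients and partial products bounded at
  \<open>\<bar>z\<bar>\<close> by \<open>exp (K \<Lambda>(\<bar>z\<bar>))\<close>, hence it converges at \<open>\<bar>z\<bar>\<close> and justifies evaluating the limit as
  the limit of the values.\<close>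
lemma evaluates_prodinf:
  assumes one: "\<And>s. one_upto s (f s)"
    and dom: "\<And>s. dominated (f s) (geo 1 (Suc s) ^ K)"
    and "\<bar>z\<bar> < 1"
    and ev: "\<And>s. evaluates (f s) z (exp (a s))" and "a sums L"
  shows "evaluates (prodinf f) z (exp L)"
proof -
  define g where "g = (\<lambda>s. geo 1 (Suc s) ^ K)"
  define G where "G = (\<lambda>N. \<Prod>s<N. g s)"
  define B where "B = (\<lambda>n. G n $ n * \<bar>z\<bar> ^ n)"
  have g_one: "one_upto s (g s)" for s
    unfolding g_def by (intro one_upto_power one_upto_geo) simp
  have g_nonneg: "nonneg_coeffs (g s)" for s
    unfolding g_def by (intro nonneg_coeffs_power nonneg_coeffs_geo)
  have G_nonneg: "nonneg_coeffs (G N)" for N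
    unfolding G_def by (intro nonneg_coeffs_prod g_nonneg)
  have G_mono: "G N $ n \<le> G M $ n" if "N \<le> M" for N M n
  proof (rule lift_Suc_mono_le[OF _ that])
    fix N
    have "dominated 1 (g N)"
      unfolding dominated_def using g_nonneg[of N] g_one[of N] by (auto simp: nonneg_coeffs_def one_upto_def)
    then have "dominated (G N * 1) (G N * g N)"
      using G_nonneg[of N] by (intro dominated_mult) (simp_all add: nonneg_iff_dominated_self)
    then show "G N $ n \<le> G (Suc N) $ n"
      by (auto simp: G_def dominated_def intro: order.trans[OF abs_ge_self])
  qed
  have G_stable: "G N $ n = G n $ n" if "n \<le> N" for n N
    using prodinf_nth[of g, OF g_one that] prodinf_nth[of g, OF g_one order.refl, of n] by (simp add: G_def)
  have G_le: "G N $ n \<le> G n $ n" for N n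
    using G_stable[of n N] G_mono[of N n n] by (cases "n \<le> N") auto

  have "summable B"
  proof (rule summableI_nonneg_bounded)
    show "0 \<le> B n" for n using G_nonneg[of n] by (simp add: B_def nonneg_coeffs_def)
    show "(\<Sum>n<N. B n) \<le> exp (real K * lambert \<bar>z\<bar>)" for N
    proof -
      have lam: "(\<lambda>r. - ln (1 - \<bar>z\<bar> ^ Suc r)) sums lambert \<bar>z\<bar>"
        using assms(3) by (intro lambert_sums) simp
      have lnn: "0 \<le> - ln (1 - \<bar>z\<bar> ^ Suc r)" for r
        using abs_power_less_one[of z "Suc r"] assms(3) by (simp add: power_abs del: power_Suc)
      have "evaluates (g s) \<bar>z\<bar> (exp (real K * - ln (1 - \<bar>z\<bar> ^ Suc s)))" for s
        unfolding g_def using assms(3) by (intro evaluates_exp_power evaluates_geo_one) auto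
      then have evG: "evaluates (G N) \<bar>z\<bar> (exp (\<Sum>s<N. real K * - ln (1 - \<bar>z\<bar> ^ Suc s)))"
        unfolding G_def exp_sum[OF finite_lessThan] by (intro evaluates_prod)
      have "(\<Sum>n<N. B n) = (\<Sum>n<N. G N $ n * \<bar>z\<bar> ^ n)"
        unfolding B_def using G_stable[of _ N] by (intro sum.cong refl) simp
      also have "\<dots> \<le> exp (\<Sum>s<N. real K * - ln (1 - \<bar>z\<bar> ^ Suc s))"
        using evG G_nonneg[of N] sum_le_suminf[of "\<lambda>n. G N $ n * \<bar>z\<bar> ^ n" "{..<N}"]
        by (simp add: evaluates_def sums_iff nonneg_coeffs_def)
      also have "(\<Sum>s<N. real K * - ln (1 - \<bar>z\<bar> ^ Suc s)) = real K * (\<Sum>s<N. - ln (1 - \<bar>z\<bar> ^ Suc s))"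
        by (simp only: sum_distrib_left)
      also have "(\<Sum>s<N. - ln (1 - \<bar>z\<bar> ^ Suc s)) \<le> lambert \<bar>z\<bar>"
        unfolding sums_unique[OF lam] by (rule sum_le_suminf[OF sums_summable[OF lam]]) (use lnn in auto)
      finally show ?thesis by (simp add: mult_left_mono)
    qed
  qed
  define F where "F = (\<lambda>N. \<Prod>s<N. f s)"
  have evF: "evaluates (F N) z (exp (\<Sum>s<N. a s))" for N
    unfolding F_def exp_sum[OF finite_lessThan] by (intro evaluates_prod ev)
  have F_le: "\<bar>F N $ n\<bar> \<le> G n $ n" for N n
  proof -
    have "dominated (F N) (G N)" unfolding F_def G_def g_def by (intro dominated_prod dom)
    then show ?thesis using G_le[of N n] by (auto simp: dominated_def intro: order.trans)
  qed
  have tan: "summable (\<lambda>n. norm (prodinf f $ n * z ^ n)) \<and>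
       ((\<lambda>N. suminf (\<lambda>n. F N $ n * z ^ n)) \<longlongrightarrow> suminf (\<lambda>n. prodinf f $ n * z ^ n)) sequentially"
  proof (rule tannerys_theorem[THEN conjunct2])
    fix n
    have "\<forall>\<^sub>F N in sequentially. F N $ n * z ^ n = prodinf f $ n * z ^ n"
      using eventually_ge_at_top[of n]
      by eventually_elim (simp add: F_def prodinf_nth[OF one])
    then show "((\<lambda>N. F N $ n * z ^ n) \<longlongrightarrow> prodinf f $ n * z ^ n) sequentially"
      by (rule tendsto_eventually)
  next
    show "\<forall>\<^sub>F (n, N) in sequentially \<times>\<^sub>F sequentially. norm (F N $ n * z ^ n) \<le> B n"
      by (intro always_eventually) (auto simp: abs_mult power_abs B_def intro!: mult_right_mono F_le)
    show "summable B" by fact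
  qed simp
  have "((\<lambda>N. exp (\<Sum>s<N. a s)) \<longlongrightarrow> exp L) sequentially"
    using \<open>a sums L\<close> unfolding sums_def by (intro tendsto_exp)
  moreover have "(\<lambda>N. suminf (\<lambda>n. F N $ n * z ^ n)) = (\<lambda>N. exp (\<Sum>s<N. a s))"
    using evF by (auto simp: evaluates_def sums_iff)
  ultimately have "suminf (\<lambda>n. prodinf f $ n * z ^ n) = exp L"
    using tan LIMSEQ_unique by metis
  then show ?thesis
    using tan summable_norm_cancel[of "\<lambda>n. prodinf f $ n * z ^ n"] by (simp add: evaluates_def sums_iff)
qed

section \<open>The two generating series as infinite products\<close>

text \<open>The series \<open>(1 + X\<^sup>k)\<^bsup>-e\<^esup>\<close>, for \<open>k > 0\<close>.\<close>
definition plus_factor :: "int \<Rightarrow> nat \<Rightarrow> real fps" where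
  "plus_factor e k = (if 0 \<le> e then geo (- 1) k ^ nat e else (1 + fps_X ^ k) ^ nat (- e))"

lemma inverse_one_plus: "0 < k \<Longrightarrow> inverse (1 + fps_X ^ k) = geo (- 1) k"
  using inverse_eq_geo[of k "- 1"] by (simp flip: fps_const_neg)

lemma one_divide_fps: "F $ 0 \<noteq> 0 \<Longrightarrow> 1 / F = inverse F" for F :: "real fps"
  by (simp add: fps_divide_unit)

lemma one_divide_one_minus_powi:
  assumes "0 < k" "0 \<le> m"
  shows "1 / (1 - fps_X ^ k) powi m = geo 1 k ^ nat m"
proof -
  have "((1 - fps_X ^ k) ^ nat m) $ 0 \<noteq> (0::real)"
    using assms by (simp add: fps_X_power_nth)
  then show ?thesis
    using assms inverse_eq_geo[of k 1] by (simp add: power_int_def one_divide_fps fps_inverse_power)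
qed

lemma one_divide_one_plus_powi:
  assumes "0 < k"
  shows "1 / (1 + fps_X ^ k) powi e = plus_factor e k"
proof -
  have nz: "(1 + fps_X ^ k) $ 0 \<noteq> (0::real)" "((1 + fps_X ^ k) ^ n) $ 0 \<noteq> (0::real)" for n
    using assms by (simp_all add: fps_X_power_nth)
  have nz': "(inverse (1 + fps_X ^ k) ^ n) $ 0 \<noteq> (0::real)" for n
    using assms by (simp add: fps_X_power_nth)
  show ?thesis
  proof (cases "0 \<le> e")
    case True
    then show ?thesis
      using assms nz
      by (simp add: power_int_def plus_factor_def one_divide_fps fps_inverse_power inverse_one_plus)
  next
    case False
    have "1 / (1 + fps_X ^ k) powi e = 1 / inverse (1 + fps_X ^ k :: real fps) ^ nat (- e)"
      using False by (simp add: power_int_def)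
    also have "\<dots> = inverse (inverse (1 + fps_X ^ k) ^ nat (- e))"
      by (rule one_divide_fps[OF nz'])
    also have "\<dots> = (1 + fps_X ^ k :: real fps) ^ nat (- e)"
      using nz(1) by (simp only: fps_inverse_power fps_inverse_idempotent not_False_eq_True)
    finally show ?thesis using False by (simp add: plus_factor_def)
  qed
qed

lemma one_upto_plus_factor: "s < k \<Longrightarrow> one_upto s (plus_factor e k)"
  by (simp add: plus_factor_def one_upto_power one_upto_geo one_upto_one_plus)

lemma dominated_plus_factor: "0 < k \<Longrightarrow> dominated (plus_factor e k) (geo 1 k ^ nat \<bar>e\<bar>)"
  by (simp add: plus_factor_def dominated_power dominated_geo dominated_one_plus)

lemma evaluates_plus_factor:
  assumes "\<bar>z\<bar> < 1" "0 < k"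
  shows "evaluates (plus_factor e k) z (exp (- real_of_int e * ln (1 + z ^ k)))"
proof -
  have pos: "0 < 1 + z ^ k" using abs_power_less_one[OF assms] by linarith
  have "evaluates (geo (- 1) k) z (exp (- ln (1 + z ^ k)))"
    using evaluates_geo[of z "- 1" k] assms pos by (simp add: exp_minus inverse_eq_divide)
  moreover have "evaluates (1 + fps_X ^ k) z (exp (ln (1 + z ^ k)))"
    using evaluates_one_plus[of 1 k z] pos by simp
  ultimately show ?thesis
  proof (cases "0 \<le> e")
    case True
    with evaluates_exp_power[OF \<open>evaluates (geo (- 1) k) z _\<close>, of "nat e"] show ?thesis
      by (simp add: plus_factor_def)
  next
    case False
    with evaluates_exp_power[OF \<open>evaluates (1 + fps_X ^ k) z _\<close>, of "nat (- e)"] show ?thesis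
      by (simp add: plus_factor_def)
  qed
qed

definition plus_product :: "int \<Rightarrow> real fps" where
  "plus_product e = prodinf (\<lambda>r. plus_factor e (Suc r))"

definition geo_product :: "nat \<Rightarrow> nat \<Rightarrow> real fps" where
  "geo_product d m = prodinf (\<lambda>s. geo 1 (d * Suc s) ^ m)"

lemma complex_series_eq: "complex_series = geo_product 1 24"
proof -
  have "1 / (1 - fps_X ^ Suc s) powi e_C = geo 1 (1 * Suc s) ^ 24" for s
    using one_divide_one_minus_powi[of "Suc s" e_C] by (simp add: e_C_def)
  then show ?thesis unfolding complex_series_def geo_product_def by (simp only:)
qed

lemma welschinger_series_eq:
  assumes "e \<le> 24"
  shows "welschinger_series e = plus_product e * geo_product 2 (nat ((24 - e) div 2))"
  using assms
  by (simp add: welschinger_series_def plus_product_def geo_product_def e_C_def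
      one_divide_one_minus_powi one_divide_one_plus_powi del: power_Suc mult_Suc_right)

lemma geo_product_nth:
  assumes "0 < d" "n \<le> N"
  shows "geo_product d m $ n = ((\<Prod>s<N. geo 1 (d * Suc s)) ^ m) $ n"
proof -
  have "s < d * Suc s" for s using assms(1) by (cases d) auto
  then have "geo_product d m $ n = (\<Prod>s<N. geo 1 (d * Suc s) ^ m) $ n"
    unfolding geo_product_def using assms(2)
    by (intro prodinf_nth one_upto_power one_upto_geo)
  then show ?thesis by (simp only: prod_power_distrib)
qed

lemma plus_product_nth: "n \<le> N \<Longrightarrow> plus_product e $ n = (\<Prod>r<N. plus_factor e (Suc r)) $ n"
  unfolding plus_product_def by (intro prodinf_nth one_upto_plus_factor) auto

lemma evaluates_geo_product:
  assumes "\<bar>z\<bar> < 1" "0 < d"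
  shows "evaluates (geo_product d m) z (exp (real m * lambert (z ^ d)))"
  unfolding geo_product_def
proof (rule evaluates_prodinf)
  fix s
  have "s < d * Suc s" using assms(2) by (cases d) auto
  then show "one_upto s (geo 1 (d * Suc s) ^ m)"
    by (intro one_upto_power one_upto_geo)
  show "dominated (geo 1 (d * Suc s) ^ m) (geo 1 (Suc s) ^ m)"
    by (intro dominated_power dominated_geo_dvd dvd_triv_right)
  show "evaluates (geo 1 (d * Suc s) ^ m) z (exp (real m * - ln (1 - (z ^ d) ^ Suc s)))"
    unfolding power_mult[symmetric] using assms
    by (intro evaluates_exp_power evaluates_geo_one) auto
next
  show "(\<lambda>s. real m * - ln (1 - (z ^ d) ^ Suc s)) sums (real m * lambert (z ^ d))"
    using assms by (intro sums_mult lambert_sums abs_power_less_one)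
qed fact

text \<open>The factorisation \<open>1 - y\<^sup>2 = (1 + y) (1 - y)\<close> expresses the logarithm of \<open>1 + z\<^sup>r\<close> by the
  logarithms that sum to \<open>lambert\<close>.\<close>
lemma evaluates_plus_product:
  assumes "\<bar>z\<bar> < 1"
  shows "evaluates (plus_product e) z (exp (real_of_int e * (lambert (z ^ 2) - lambert z)))"
  unfolding plus_product_def
proof (rule evaluates_prodinf)
  fix s
  show "one_upto s (plus_factor e (Suc s))" by (simp add: one_upto_plus_factor)
  show "dominated (plus_factor e (Suc s)) (geo 1 (Suc s) ^ nat \<bar>e\<bar>)" by (simp add: dominated_plus_factor)
  show "evaluates (plus_factor e (Suc s)) z (exp (- real_of_int e * ln (1 + z ^ Suc s)))"
    by (intro evaluates_plus_factor assms) simp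
next
  have eq: "- real_of_int e * ln (1 + z ^ Suc s)
      = real_of_int e * (- ln (1 - (z ^ 2) ^ Suc s) - - ln (1 - z ^ Suc s))" for s
  proof -
    define y where "y = z ^ Suc s"
    have "\<bar>y\<bar> < 1" unfolding y_def by (rule abs_power_less_one[OF assms]) simp
    then have "0 < 1 + y" "0 < 1 - y" by linarith+
    moreover have "(z ^ 2) ^ Suc s = y ^ 2" by (simp only: y_def power_mult[symmetric] mult.commute)
    moreover have "1 - y ^ 2 = (1 + y) * (1 - y)" by (simp add: power2_eq_square algebra_simps)
    ultimately have "ln (1 - (z ^ 2) ^ Suc s) = ln (1 + y) + ln (1 - y)" by (simp add: ln_mult)
    then show ?thesis by (simp add: y_def)
  qed
  show "(\<lambda>s. - real_of_int e * ln (1 + z ^ Suc s)) sums (real_of_int e * (lambert (z ^ 2) - lambert z))"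
    unfolding eq using assms by (intro sums_mult sums_diff lambert_sums abs_power_less_one) simp_all
qed fact

section \<open>Nonnegative and nondecreasing coefficients\<close>

lemma one_minus_mult_one_plus_geo: "(1 - fps_X) * ((1 + fps_X) * geo 1 2) = 1"
proof -
  have "(1 - fps_X) * ((1 + fps_X) * geo 1 2) = geo 1 2 * (1 - fps_const 1 * fps_X ^ 2)"
    by (simp add: power2_eq_square algebra_simps)
  then show ?thesis by (simp only: geo_mult[OF zero_less_numeral])
qed

text \<open>The coefficients of \<open>(1 - X\<^sup>k) F\<close> are the differences of coefficients of \<open>F\<close> at distance \<open>k\<close>.\<close>
lemma nth_le_nth_add:
  assumes "nonneg_coeffs ((1 - fps_X ^ k) * F)"
  shows "F $ n \<le> F $ (n + k)"
proof -
  have "(1 - fps_X ^ k) * F = F - fps_X ^ k * F" by (simp add: algebra_simps)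
  then have "((1 - fps_X ^ k) * F) $ (n + k) = F $ (n + k) - F $ n"
    by (simp add: fps_X_power_mult_nth)
  then show ?thesis using assms unfolding nonneg_coeffs_def by (metis diff_ge_0_iff_ge)
qed

lemma nonneg_coeffs_cancel_power:
  assumes "F * A = 1" "nonneg_coeffs A" "nonneg_coeffs B" "0 < m"
  shows "nonneg_coeffs (F * (A * B) ^ m)"
proof -
  obtain m' where m: "m = Suc m'" using assms(4) gr0_implies_Suc by blast
  have "F * (A * B) ^ m = (F * A) * (B * (A * B) ^ m')" by (simp add: m mult_ac)
  then show ?thesis
    using assms by (simp add: nonneg_coeffs_mult nonneg_coeffs_power)
qed

lemma geo_product_partial_head:
  assumes "0 < N"
  shows "\<exists>B. nonneg_coeffs B \<and> (\<Prod>s<N. geo 1 (d * Suc s)) = geo 1 d * B"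
proof -
  obtain M where N: "N = Suc M" using assms gr0_implies_Suc by blast
  have "(\<Prod>s<N. geo 1 (d * Suc s)) = geo 1 d * (\<Prod>s<M. geo 1 (d * Suc (Suc s)))"
    unfolding N prod.lessThan_Suc_shift by (simp del: mult_Suc_right) simp
  moreover have "nonneg_coeffs (\<Prod>s<M. geo 1 (d * Suc (Suc s)))"
    by (intro nonneg_coeffs_prod nonneg_coeffs_geo)
  ultimately show ?thesis by blast
qed

lemma plus_product_partial_head:
  assumes "0 < N"
  shows "\<exists>A. nonneg_coeffs A \<and> (\<Prod>r<N. 1 + fps_X ^ Suc (h * r)) = (1 + fps_X) * A"
proof -
  obtain M where N: "N = Suc M" using assms gr0_implies_Suc by blast
  have "(\<Prod>r<N. 1 + fps_X ^ Suc (h * r)) = (1 + fps_X) * (\<Prod>r<M. 1 + fps_X ^ Suc (h * Suc r) :: real fps)"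
    unfolding N prod.lessThan_Suc_shift by simp
  moreover have "nonneg_coeffs (\<Prod>r<M. 1 + fps_X ^ Suc (h * Suc r))"
    by (intro nonneg_coeffs_prod nonneg_coeffs_one_plus)
  ultimately show ?thesis by blast
qed

text \<open>One copy of \<open>1 + X\<close> and one of \<open>1 / (1 - X\<^sup>2)\<close> cancel the factor \<open>1 - X\<close>, and everything else
  has nonnegative coefficients. The step \<open>h\<close> covers the products over all exponents (\<open>h = 1\<close>) and
  over odd exponents (\<open>h = 2\<close>).\<close>
lemma nonneg_one_minus_mult_partial:
  assumes "0 < N" "0 < p" "0 < m" "nonneg_coeffs T"
  shows "nonneg_coeffs ((1 - fps_X) * (((\<Prod>r<N. 1 + fps_X ^ Suc (h * r)) * T) ^ p * (\<Prod>s<N. geo 1 (2 * Suc s)) ^ m))"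
proof -
  obtain A where A: "nonneg_coeffs A" "(\<Prod>r<N. 1 + fps_X ^ Suc (h * r)) = (1 + fps_X) * A"
    using plus_product_partial_head[OF assms(1)] by blast
  obtain B where B: "nonneg_coeffs B" "(\<Prod>s<N. geo 1 (2 * Suc s)) = geo 1 2 * B"
    using geo_product_partial_head[OF assms(1)] by blast
  obtain p' m' where pm: "p = Suc p'" "m = Suc m'" using assms gr0_implies_Suc by metis
  have X: "nonneg_coeffs (1 + fps_X)" using nonneg_coeffs_one_plus[of 1] by simp
  have "(1 - fps_X) * (((1 + fps_X) * A * T) ^ p * (geo 1 2 * B) ^ m)
      = ((1 - fps_X) * ((1 + fps_X) * geo 1 2)) * (A * T * B * (((1 + fps_X) * A * T) ^ p' * (geo 1 2 * B) ^ m'))"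
    unfolding pm power_Suc by (simp only: mult_ac)
  also have "\<dots> = A * T * B * (((1 + fps_X) * A * T) ^ p' * (geo 1 2 * B) ^ m')"
    by (simp only: one_minus_mult_one_plus_geo mult_1)
  finally show ?thesis
    unfolding A B using A(1) B(1) X assms(4)
    by (simp only: nonneg_coeffs_mult nonneg_coeffs_power nonneg_coeffs_geo)
qed

lemma geo_factor_one_plus: "0 < k \<Longrightarrow> geo 1 k = (1 + fps_X ^ k) * geo 1 (2 * k)"
  "0 < k \<Longrightarrow> geo 1 (2 * k) = geo 1 k * geo (- 1) k"
proof -
  assume k: "0 < k"
  have a: "geo 1 k * (1 - fps_X ^ k) = 1" and b: "geo 1 (2 * k) * (1 - fps_X ^ (2 * k)) = 1"
    and c: "geo (- 1) k * (1 + fps_X ^ k) = 1"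
    using geo_mult[of k 1] geo_mult[of "2 * k" 1] geo_mult[of k "- 1"] k by (simp_all flip: fps_const_neg)
  have sq: "1 - fps_X ^ (2 * k) = (1 - fps_X ^ k) * (1 + fps_X ^ k :: real fps)"
  proof -
    have "1 - y ^ 2 = (1 - y) * (1 + y)" for y :: "real fps" by (simp add: power2_eq_square algebra_simps)
    then show ?thesis by (simp only: mult.commute[of 2] power_mult)
  qed
  have "geo 1 k * (geo 1 (2 * k) * (1 - fps_X ^ (2 * k)))
      = (geo 1 k * (1 - fps_X ^ k)) * ((1 + fps_X ^ k) * geo 1 (2 * k))"
    unfolding sq by (simp only: mult_ac)
  then show "geo 1 k = (1 + fps_X ^ k) * geo 1 (2 * k)" by (simp only: a b mult_1 mult_1_right)
  have "geo 1 (2 * k) * ((geo 1 k * (1 - fps_X ^ k)) * (geo (- 1) k * (1 + fps_X ^ k)))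
      = (geo 1 (2 * k) * (1 - fps_X ^ (2 * k))) * (geo 1 k * geo (- 1) k)"
    unfolding sq by (simp only: mult_ac)
  then show "geo 1 (2 * k) = geo 1 k * geo (- 1) k" by (simp only: a b c mult_1 mult_1_right)
qed

lemma geo_ne_zero: "geo c k \<noteq> 0"
proof -
  have "geo c k $ 0 = 1" by (simp add: geo_def)
  then show ?thesis by auto
qed

text \<open>A finite form of Euler's identity. The factors on the left are \<open>1 / (1 + (-X)\<^sup>k)\<close> for
  \<open>k = 1, \<dots>, 2N\<close>: for odd \<open>k\<close> this is \<open>1 / (1 - X\<^sup>k) = (1 + X\<^sup>k) / (1 - X\<^bsup>2k\<^esup>)\<close>, while for even \<open>k\<close> it
  equals \<open>(1 - X\<^sup>k) / (1 - X\<^bsup>2k\<^esup>)\<close>, whose numerator cancels an earlier denominator. Hence the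
  partial products with an even number of factors already have nonnegative coefficients.\<close>
lemma euler_odd_even_partial:
  "(\<Prod>r<2 * N. geo ((- 1) ^ r) (Suc r))
     = (\<Prod>r<N. 1 + fps_X ^ Suc (2 * r)) * (\<Prod>r\<in>{N..<2 * N}. geo 1 (2 * Suc r))"
proof (induction N)
  case 0
  then show ?case by simp
next
  case (Suc N)
  let ?T = "\<lambda>N. \<Prod>r\<in>{N..<2 * N}. geo 1 (2 * Suc r)"
  let ?O = "\<Prod>r<N. 1 + fps_X ^ Suc (2 * r) :: real fps"
  \<comment> \<open>Passing from \<open>N\<close> to \<open>Suc N\<close> removes \<open>?g\<close> from the last product, so the claim is proved times \<open>?g\<close>.\<close>
  let ?g = "geo 1 (2 * Suc N)"
  have T: "?T (Suc N) * ?g = ?T N * (geo 1 (2 * Suc (2 * N)) * geo 1 (2 * Suc (Suc (2 * N))))"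
  proof -
    have "?T (Suc N) * ?g = (\<Prod>r\<in>{N..<2 * Suc N}. geo 1 (2 * Suc r))"
      by (subst prod.atLeast_Suc_lessThan[of N]) (simp_all add: mult.commute del: mult_Suc_right)
    also have "\<dots> = ?T N * (geo 1 (2 * Suc (2 * N)) * geo 1 (2 * Suc (Suc (2 * N))))"
    proof -
      have "(\<Prod>r\<in>{N..<2 * Suc N}. g r) = (\<Prod>r\<in>{N..<2 * N}. g r) * (g (2 * N) * g (Suc (2 * N)))"
        for g :: "nat \<Rightarrow> real fps"
        by (simp add: prod.atLeastLessThan_Suc mult.assoc)
      then show ?thesis .
    qed
    finally show ?thesis .
  qed
  have a: "geo 1 (Suc (2 * N)) = (1 + fps_X ^ Suc (2 * N)) * geo 1 (2 * Suc (2 * N))"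
    by (rule geo_factor_one_plus) simp
  have b: "geo 1 (2 * Suc (Suc (2 * N))) = ?g * geo (- 1) (Suc (Suc (2 * N)))"
    using geo_factor_one_plus(2)[of "Suc (Suc (2 * N))"] by simp
  have "(\<Prod>r<2 * Suc N. geo ((- 1) ^ r) (Suc r)) * ?g
      = (\<Prod>r<2 * N. geo ((- 1) ^ r) (Suc r)) * geo 1 (Suc (2 * N)) * (?g * geo (- 1) (Suc (Suc (2 * N))))"
    by (simp add: mult_ac)
  also have "\<dots> = ?O * (1 + fps_X ^ Suc (2 * N)) * (?T N * (geo 1 (2 * Suc (2 * N)) * geo 1 (2 * Suc (Suc (2 * N)))))"
    unfolding Suc.IH a b by (simp only: mult_ac)
  also have "\<dots> = (\<Prod>r<Suc N. 1 + fps_X ^ Suc (2 * r)) * ?T (Suc N) * ?g"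
    unfolding T[symmetric] by (simp only: prod.lessThan_Suc mult_ac)
  finally show ?case using geo_ne_zero[of 1 "2 * Suc N"] by (simp only: mult_cancel_right) simp
qed

text \<open>Comparing two coefficients of an infinite product requires only a partial product that agrees with
  it far enough.\<close>
lemma nth_le_nth_add_of_truncation:
  assumes "nonneg_coeffs ((1 - fps_X ^ k) * G)" and "\<And>i. i \<le> n + k \<Longrightarrow> F $ i = G $ i"
  shows "F $ n \<le> F $ (n + k)"
  using nth_le_nth_add[OF assms(1), of n] assms(2) by simp

lemma geo_product_mono:
  assumes "0 < d" "0 < m"
  shows "geo_product d m $ n \<le> geo_product d m $ (n + d)"
proof (rule nth_le_nth_add_of_truncation)
  obtain B where B: "nonneg_coeffs B" "(\<Prod>s<n + d. geo 1 (d * Suc s)) = geo 1 d * B"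
    using geo_product_partial_head[of "n + d" d] assms by auto
  have "(1 - fps_X ^ d) * geo 1 d = 1"
    using geo_mult[of d 1] assms by (simp add: mult.commute)
  then show "nonneg_coeffs ((1 - fps_X ^ d) * (\<Prod>s<n + d. geo 1 (d * Suc s)) ^ m)"
    unfolding B using B(1) assms by (intro nonneg_coeffs_cancel_power nonneg_coeffs_geo)
qed (simp add: geo_product_nth assms)

lemma welschinger_negative_mono:
  assumes "e < 0"
  shows "welschinger_series e $ n \<le> welschinger_series e $ Suc n"
proof -
  define m where "m = nat ((24 - e) div 2)"
  define P where "P = (\<Prod>r<Suc n. 1 + fps_X ^ Suc (1 * r) :: real fps)"
  define B where "B = (\<Prod>s<Suc n. geo 1 (2 * Suc s))"
  have "0 < m" using assms by (simp add: m_def)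
  have "nonneg_coeffs ((1 - fps_X) * ((P * 1) ^ nat (- e) * B ^ m))"
    unfolding P_def B_def using assms \<open>0 < m\<close>
    by (intro nonneg_one_minus_mult_partial) (simp_all add: nonneg_coeffs_def)
  moreover have "welschinger_series e $ i = ((P * 1) ^ nat (- e) * B ^ m) $ i" if "i \<le> n + 1" for i
  proof -
    have "(\<Prod>r<Suc n. plus_factor e (Suc r)) = P ^ nat (- e)"
      using assms unfolding P_def prod_power_distrib by (simp add: plus_factor_def)
    then have "plus_product e $ j = (P * 1) ^ nat (- e) $ j" if "j \<le> i" for j
      using plus_product_nth[of j "Suc n" e] that \<open>i \<le> n + 1\<close> by simp
    moreover have "geo_product 2 m $ j = (B ^ m) $ j" if "j \<le> i" for j
      unfolding B_def using that \<open>i \<le> n + 1\<close> by (intro geo_product_nth) auto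
    ultimately show ?thesis
      using assms by (simp only: welschinger_series_eq m_def[symmetric]) (intro mult_nth_cong; simp)
  qed
  ultimately show ?thesis
    using nth_le_nth_add_of_truncation[of 1 _ n] by (metis Suc_eq_plus1 power_one_right)
qed

text \<open>The signs \<open>(-1)\<^sup>n\<close> are the substitution \<open>X \<mapsto> -X\<close>. Twice as many factors \<open>1 + X\<^sup>r\<close> are taken
  as factors \<open>1 - X\<^bsup>2s\<^esup>\<close>, because Euler's identity pairs an odd exponent with the next even one.\<close>
lemma welschinger_positive_mono:
  assumes "0 < e" "e \<le> 20"
  shows "(- 1) ^ n * welschinger_series e $ n \<le> (- 1) ^ Suc n * welschinger_series e $ Suc n"
proof -
  define c :: "real fps" where "c = fps_const (- 1) * fps_X"
  have c0: "c $ 0 = 0" by (simp add: c_def)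
  define m where "m = nat ((24 - e) div 2)"
  have "0 < m" using assms by (simp add: m_def)
  define N where "N = Suc n"
  \<comment> \<open>The partial products of \<open>1 / (1 + (-X)\<^sup>k)\<close>; the exponent \<open>k = Suc r\<close> is odd when \<open>r\<close> is even.\<close>
  define P where "P = (\<Prod>r<2 * N. geo ((- 1) ^ r) (Suc r))"
  define P' where "P' = (\<Prod>r<2 * N. plus_factor e (Suc r))"
  define B where "B = (\<Prod>s<N. geo 1 (2 * Suc s))"
  have P': "fps_compose P' c = P ^ nat e"
  proof -
    have "fps_compose (plus_factor e (Suc r)) c = geo ((- 1) ^ r) (Suc r) ^ nat e" for r
    proof -
      have "fps_compose (plus_factor e (Suc r)) c = fps_compose (geo (- 1) (Suc r)) c ^ nat e"
        using assms by (simp add: plus_factor_def fps_compose_power[OF c0])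
      also have "fps_compose (geo (- 1) (Suc r)) c = geo ((- 1) ^ r) (Suc r)"
        unfolding c_def by (subst geo_compose_linear) simp_all
      finally show ?thesis .
    qed
    then show ?thesis
      unfolding P'_def P_def by (simp only: fps_compose_prod_distrib[OF c0] prod_power_distrib)
  qed
  have B': "fps_compose (B ^ m) c = B ^ m"
  proof -
    have "fps_compose (geo 1 (2 * Suc s)) c = geo 1 (2 * Suc s)" for s
      unfolding c_def by (subst geo_compose_linear) (simp_all del: mult_Suc_right)
    then show ?thesis
      unfolding B_def by (simp only: fps_compose_power[OF c0, symmetric] fps_compose_prod_distrib[OF c0])
  qed
  have "nonneg_coeffs ((1 - fps_X) * (P ^ nat e * B ^ m))"
    unfolding P_def B_def euler_odd_even_partial using assms \<open>0 < m\<close>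
    by (intro nonneg_one_minus_mult_partial nonneg_coeffs_prod nonneg_coeffs_geo) (simp_all add: N_def)
  moreover have "fps_compose (welschinger_series e) c $ i = (P ^ nat e * B ^ m) $ i" if "i \<le> n + 1" for i
  proof -
    have "welschinger_series e $ i = (P' * B ^ m) $ i"
    proof -
      have "plus_product e $ j = P' $ j" if "j \<le> i" for j
        unfolding P'_def using that \<open>i \<le> n + 1\<close> by (intro plus_product_nth) (simp add: N_def)
      moreover have "geo_product 2 m $ j = (B ^ m) $ j" if "j \<le> i" for j
        unfolding B_def using that \<open>i \<le> n + 1\<close> by (intro geo_product_nth) (simp_all add: N_def)
      ultimately show ?thesis
        using assms by (simp only: welschinger_series_eq m_def[symmetric]) (intro mult_nth_cong; simp)
    qed
    then have "fps_compose (welschinger_series e) c $ i = fps_compose (P' * B ^ m) c $ i"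
      by (simp only: c_def fps_nth_compose_linear)
    then show ?thesis by (simp only: fps_compose_mult_distrib[OF c0] P' B')
  qed
  ultimately have "fps_compose (welschinger_series e) c $ n \<le> fps_compose (welschinger_series e) c $ Suc n"
    using nth_le_nth_add_of_truncation[of 1 _ n] by (metis Suc_eq_plus1 power_one_right)
  then show ?thesis by (simp only: c_def fps_nth_compose_linear)
qed

section \<open>Growth of the coefficients\<close>

lemma geo_product_nth_0: "0 < d \<Longrightarrow> geo_product d m $ 0 = 1"
  using geo_product_nth[of d 0 0 m] by simp

lemma welschinger_series_nth_0: "e \<le> 24 \<Longrightarrow> welschinger_series e $ 0 = 1"
  using plus_product_nth[of 0 0 e] by (simp add: welschinger_series_eq geo_product_nth_0)

lemma evaluates_welschinger_series:
  assumes "\<bar>z\<bar> < 1" "e \<le> 24" "even e"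
  shows "evaluates (welschinger_series e) z
    (exp (real_of_int e * (lambert (z ^ 2) - lambert z) + real_of_int (24 - e) / 2 * lambert (z ^ 2)))"
proof -
  have "real (nat ((24 - e) div 2)) = real_of_int (24 - e) / 2"
    using assms(2,3) by (auto elim!: evenE)
  note m = this
  show ?thesis
    using evaluates_mult[OF evaluates_plus_product[OF assms(1), of e]
        evaluates_geo_product[OF assms(1), of 2 "nat ((24 - e) div 2)"]]
    unfolding m exp_add welschinger_series_eq[OF assms(2)] by simp
qed

text \<open>With \<open>\<sigma> = 1\<close> or \<open>\<sigma> = -1\<close>, the series of the \<open>\<sigma>\<^sup>n W\<^sub>n\<close> at \<open>e\<^bsup>-t\<^esup>\<close> is \<open>W\<close> at \<open>\<sigma> e\<^bsup>-t\<^esup>\<close>. Since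
  these coefficients start with 1 and do not decrease, they are the absolute values of those of \<open>W\<close>.\<close>
lemma log_signed_coeff_asymptotics:
  fixes \<sigma> :: real
  assumes "W $ 0 = 1" "\<bar>\<sigma>\<bar> = 1"
    and mono: "\<And>n. \<sigma> ^ n * W $ n \<le> \<sigma> ^ Suc n * W $ Suc n"
    and ev: "\<And>t. 0 < t \<Longrightarrow> evaluates W (\<sigma> * exp (- t)) (exp (h t))"
    and lim: "((\<lambda>t. t * h t) \<longlongrightarrow> C) (at_right 0)" and "0 < C"
  shows "(\<lambda>n. ln \<bar>W $ n\<bar> - 2 * sqrt C * sqrt (real n)) \<in> o(\<lambda>n. sqrt (real n))"
proof -
  define c where "c = (\<lambda>n. \<sigma> ^ n * W $ n)"
  have "mono c" unfolding c_def by (rule monoI, rule lift_Suc_mono_le) (use mono in auto)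
  have pos: "0 < c n" for n
    using monoD[OF \<open>mono c\<close>, of 0 n] assms(1) by (simp add: c_def)
  have "\<bar>W $ n\<bar> = c n" for n
    using pos[of n] assms(2) by (metis abs_mult abs_of_pos c_def mult_1 power_abs power_one)
  moreover have "(\<lambda>n. ln (c n) - 2 * sqrt C * sqrt (real n)) \<in> o(\<lambda>n. sqrt (real n))"
  proof (rule log_coeff_asymptotics[OF pos \<open>mono c\<close>])
    show "(\<lambda>n. c n * exp (- (real n * t))) sums exp (h t)" if "0 < t" for t
    proof -
      have "W $ n * (\<sigma> * exp (- t)) ^ n = c n * exp (- (real n * t))" for n
        by (simp add: c_def power_mult_distrib flip: exp_of_nat_mult)
      then show ?thesis using ev[OF that] by (simp add: evaluates_def)
    qed
  qed (use lim \<open>0 < C\<close> in simp_all)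
  ultimately show ?thesis by simp
qed

lemma complex_series_pos: "0 < complex_series $ n"
proof -
  have "1 \<le> complex_series $ n"
    by (induction n) (use geo_product_mono[of 1 24] in \<open>auto simp: complex_series_eq geo_product_nth_0 intro: order.trans\<close>)
  then show ?thesis by simp
qed

lemma log_complex_asymptotics: "(\<lambda>g. ln (\<psi> g) - 4 * pi * sqrt (real g)) \<in> o(\<lambda>g. sqrt (real g))"
proof -
  have "(\<lambda>n. ln \<bar>complex_series $ n\<bar> - 2 * sqrt ((2 * pi)\<^sup>2) * sqrt (real n)) \<in> o(\<lambda>n. sqrt (real n))"
  proof (rule log_signed_coeff_asymptotics[where \<sigma> = 1])
    show "evaluates complex_series (1 * exp (- t)) (exp (24 * lambert (exp (- t))))" if "0 < t" for t
      using evaluates_geo_product[of "exp (- t)" 1 24] that by (simp add: complex_series_eq)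
    have "((\<lambda>t. 24 * (t * lambert (exp (- t)))) \<longlongrightarrow> 24 * (pi\<^sup>2 / 6)) (at_right 0)"
      by (intro tendsto_mult_left lambert_limit_plus)
    then show "((\<lambda>t. t * (24 * lambert (exp (- t)))) \<longlongrightarrow> (2 * pi)\<^sup>2) (at_right 0)"
      by (simp add: power_mult_distrib mult.left_commute)
  qed (use geo_product_mono[of 1 24] in \<open>simp_all add: complex_series_eq geo_product_nth_0\<close>)
  moreover have "2 * sqrt ((2 * pi)\<^sup>2) = 4 * pi" by (simp only: real_sqrt_abs) simp
  ultimately show ?thesis by (simp only: \<psi>_def abs_of_pos[OF complex_series_pos])
qed

text \<open>With \<open>L\<close> the limit of \<open>t \<Lambda>(\<sigma> e\<^bsup>-t\<^esup>)\<close>, the constant is \<open>C = e (\<pi>\<^sup>2/12 - L) + (24 - e) \<pi>\<^sup>2/24\<close>. For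
  \<open>e > 0\<close>, where \<open>L = \<pi>\<^sup>2/24\<close>, this is \<open>\<pi>\<^sup>2\<close>; for \<open>e < 0\<close>, where \<open>L = \<pi>\<^sup>2/6\<close>, it is
  \<open>(24 - 3e) \<pi>\<^sup>2/24\<close>. Both are \<open>(2 \<pi> \<rho>)\<^sup>2\<close>.\<close>
lemma log_welschinger_asymptotics:
  assumes "even e" "e \<le> 20" "e \<noteq> 0"
  shows "(\<lambda>g. ln (\<phi> e g) - 4 * pi * \<rho> e * sqrt (real g)) \<in> o(\<lambda>g. sqrt (real g))"
proof -
  define \<sigma> :: real where "\<sigma> = (if 0 < e then - 1 else 1)"
  define h where "h = (\<lambda>t. real_of_int e * (lambert (exp (- t) ^ 2) - lambert (\<sigma> * exp (- t)))
      + real_of_int (24 - e) / 2 * lambert (exp (- t) ^ 2))"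
  have "2 * pi * \<rho> e > 0" using assms by (simp add: \<rho>_def e_C_def)
  have "(\<lambda>n. ln \<bar>welschinger_series e $ n\<bar> - 2 * sqrt ((2 * pi * \<rho> e)\<^sup>2) * sqrt (real n)) \<in> o(\<lambda>n. sqrt (real n))"
  proof (rule log_signed_coeff_asymptotics)
    show "welschinger_series e $ 0 = 1" using assms by (simp add: welschinger_series_nth_0)
    show "\<bar>\<sigma>\<bar> = 1" by (simp add: \<sigma>_def)
    show "\<sigma> ^ n * welschinger_series e $ n \<le> \<sigma> ^ Suc n * welschinger_series e $ Suc n" for n
      using welschinger_positive_mono[of e n] welschinger_negative_mono[of e n] assms
      by (cases "0 < e") (simp_all add: \<sigma>_def)
    show "evaluates (welschinger_series e) (\<sigma> * exp (- t)) (exp (h t))" if "0 < t" for t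
    proof -
      have "(\<sigma> * exp (- t)) ^ 2 = exp (- t) ^ 2" by (simp add: \<sigma>_def power_mult_distrib)
      then show ?thesis
        using evaluates_welschinger_series[of "\<sigma> * exp (- t)" e] that assms
        by (simp add: h_def \<sigma>_def abs_mult)
    qed
    define L where "L = (if 0 < e then pi\<^sup>2 / 24 else pi\<^sup>2 / 6)"
    have L: "((\<lambda>t. t * lambert (\<sigma> * exp (- t))) \<longlongrightarrow> L) (at_right 0)"
      using lambert_limit_plus lambert_limit_minus by (simp add: \<sigma>_def L_def)
    have "((\<lambda>t. real_of_int e * (t * lambert (exp (- t) ^ 2) - t * lambert (\<sigma> * exp (- t)))
        + real_of_int (24 - e) / 2 * (t * lambert (exp (- t) ^ 2)))
        \<longlongrightarrow> real_of_int e * (pi\<^sup>2 / 12 - L) + real_of_int (24 - e) / 2 * (pi\<^sup>2 / 12)) (at_right 0)"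
      by (intro tendsto_add tendsto_mult_left tendsto_diff lambert_limit_square L)
    moreover have "real_of_int e * (pi\<^sup>2 / 12 - L) + real_of_int (24 - e) / 2 * (pi\<^sup>2 / 12) = (2 * pi * \<rho> e)\<^sup>2"
      using assms by (simp add: L_def \<rho>_def e_C_def power_mult_distrib power_divide field_simps)
    moreover have "t * h t = real_of_int e * (t * lambert (exp (- t) ^ 2) - t * lambert (\<sigma> * exp (- t)))
        + real_of_int (24 - e) / 2 * (t * lambert (exp (- t) ^ 2))" for t
      by (simp add: h_def algebra_simps)
    ultimately show "((\<lambda>t. t * h t) \<longlongrightarrow> (2 * pi * \<rho> e)\<^sup>2) (at_right 0)" by simp
    show "0 < (2 * pi * \<rho> e)\<^sup>2" by (rule zero_less_power) fact
  qed
  moreover have "2 * sqrt ((2 * pi * \<rho> e)\<^sup>2) = 4 * pi * \<rho> e"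
    using \<open>2 * pi * \<rho> e > 0\<close> by (simp only: real_sqrt_abs abs_of_pos)
  ultimately show ?thesis by (simp only: \<phi>_def)
qed

text \<open>The mean of the two series keeps exactly the terms of even index.\<close>
lemma evaluates_even_part:
  assumes "evaluates W z v" "evaluates W (- z) v"
  shows "(\<lambda>n. W $ (2 * n) * (z ^ 2) ^ n) sums v"
proof -
  have "(\<lambda>n. 1 / 2 * (W $ n * z ^ n + W $ n * (- z) ^ n)) sums (1 / 2 * (v + v))"
    using assms by (intro sums_mult sums_add) (simp_all add: evaluates_def)
  then have s: "(\<lambda>n. 1 / 2 * (W $ n * z ^ n + W $ n * (- z) ^ n)) sums v" by simp
  have "(\<lambda>n. 1 / 2 * (W $ (2 * n) * z ^ (2 * n) + W $ (2 * n) * (- z) ^ (2 * n))) sums v"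
  proof (subst sums_mono_reindex[of "\<lambda>n. 2 * n" "\<lambda>n. 1 / 2 * (W $ n * z ^ n + W $ n * (- z) ^ n)"])
    show "1 / 2 * (W $ n * z ^ n + W $ n * (- z) ^ n) = 0" if "n \<notin> range (\<lambda>n. 2 * n)" for n
    proof -
      have "odd n" using that by (metis evenE rangeI)
      then show ?thesis by (simp add: power_minus_odd)
    qed
  qed (use s in \<open>auto simp: strict_mono_def\<close>)
  then show ?thesis by (simp add: power_mult)
qed

text \<open>At \<open>z = e\<^bsup>-t/2\<^esup>\<close> the even coefficients form a series in \<open>z\<^sup>2 = e\<^bsup>-t\<^esup>\<close> with value \<open>exp (12 \<Lambda>(e\<^bsup>-t\<^esup>))\<close>,
  so the Tauberian theorem applies with \<open>C = 12 \<pi>\<^sup>2/6\<close>.\<close>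
lemma log_welschinger_zero_asymptotics:
  "(\<lambda>g. ln (\<phi> 0 (2 * g)) - 2 * pi * sqrt (real (2 * g))) \<in> o(\<lambda>g. sqrt (real g))"
proof -
  define c where "c = (\<lambda>g. welschinger_series 0 $ (2 * g))"
  have "plus_product 0 $ n = (1 :: real fps) $ n" for n
    using plus_product_nth[of n n 0] by (simp add: plus_factor_def)
  then have "plus_product 0 = 1" by (intro fps_ext)
  then have W: "welschinger_series 0 = geo_product 2 12" by (simp add: welschinger_series_eq)
  have step: "c n \<le> c (Suc n)" for n
    using geo_product_mono[of 2 12 "2 * n"] by (simp add: c_def W)
  then have "mono c" by (simp add: mono_iff_le_Suc)
  have pos: "0 < c n" for n
    using monoD[OF \<open>mono c\<close>, of 0 n] by (simp add: c_def welschinger_series_nth_0)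
  have "(\<lambda>n. ln (c n) - 2 * sqrt (2 * pi\<^sup>2) * sqrt (real n)) \<in> o(\<lambda>n. sqrt (real n))"
  proof (rule log_coeff_asymptotics[OF pos \<open>mono c\<close>])
    show "(\<lambda>n. c n * exp (- (real n * t))) sums exp (12 * lambert (exp (- t)))" if "0 < t" for t
    proof -
      define z where "z = exp (- (t / 2))"
      have z: "\<bar>z\<bar> < 1" "z ^ 2 = exp (- t)"
        using that by (simp_all add: z_def power2_eq_square flip: exp_add)
      have "evaluates (welschinger_series 0) z (exp (12 * lambert (exp (- t))))"
           "evaluates (welschinger_series 0) (- z) (exp (12 * lambert (exp (- t))))"
        using evaluates_geo_product[of z 2 12] evaluates_geo_product[of "- z" 2 12] z by (simp_all add: W)
      from evaluates_even_part[OF this] show ?thesis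
        by (simp add: z(2) c_def flip: exp_of_nat_mult)
    qed
    have "((\<lambda>t. 12 * (t * lambert (exp (- t)))) \<longlongrightarrow> 12 * (pi\<^sup>2 / 6)) (at_right 0)"
      by (intro tendsto_mult_left lambert_limit_plus)
    then show "((\<lambda>t. t * ln (exp (12 * lambert (exp (- t))))) \<longlongrightarrow> 2 * pi\<^sup>2) (at_right 0)"
      by (simp add: mult.left_commute)
  qed simp
  moreover have "\<phi> 0 (2 * g) = c g" for g
    using pos[of g] by (simp add: \<phi>_def c_def)
  moreover have "2 * sqrt (2 * pi\<^sup>2) * sqrt (real n) = 2 * pi * sqrt (real (2 * n))" for n
    by (simp add: real_sqrt_mult)
  ultimately show ?thesis by (simp only:)
qed

section \<open>Counts of curves\<close>

lemma welschinger_le_real_le_complex: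
  assumes "finite (rational_curves X L)"
  shows "\<bar>welschinger_count X \<sigma> L\<bar> \<le> int (real_count X \<sigma> L)"
    and "real_count X \<sigma> L \<le> complex_count X L"
proof -
  let ?R = "real_rational_curves X \<sigma> L"
  have sub: "?R \<subseteq> rational_curves X L" by (auto simp: real_rational_curves_def)
  then have fin: "finite ?R" using assms finite_subset by blast
  show "real_count X \<sigma> L \<le> complex_count X L"
    unfolding real_count_def complex_count_def by (rule card_mono[OF assms sub])
  have "?R = {C\<in>?R. even (card (solitary_points X \<sigma> L C))} \<union> {C\<in>?R. odd (card (solitary_points X \<sigma> L C))}"
    by blast
  then have "real_count X \<sigma> L = n_plus X \<sigma> L + n_minus X \<sigma> L"
    unfolding real_count_def n_plus_def n_minus_def
    by (subst card_Un_disjoint[symmetric]) (use fin in auto)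
  then show "\<bar>welschinger_count X \<sigma> L\<bar> \<le> int (real_count X \<sigma> L)"
    by (simp add: welschinger_count_def)
qed

theorem corollary2p4:
  "(\<forall>(X :: 'a surface) \<sigma> L g.
      generic_real_K3 X \<sigma> L g \<longrightarrow>
      real (complex_count X L) = fps_nth complex_series g \<longrightarrow>
      real_of_int (welschinger_count X \<sigma> L) = fps_nth (welschinger_series (euler_real X \<sigma>)) g \<longrightarrow>
        \<phi> (euler_real X \<sigma>) g = real_of_int \<bar>welschinger_count X \<sigma> L\<bar> \<and>
        \<bar>welschinger_count X \<sigma> L\<bar> \<le> int (real_count X \<sigma> L) \<and>
        real_count X \<sigma> L \<le> complex_count X L \<and>
        real (complex_count X L) = \<psi> g)
   \<and> (\<lambda>g. ln (\<psi> g) - 4 * pi * sqrt (real g)) \<in> o(\<lambda>g. sqrt (real g))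
   \<and> (\<forall>e_R :: int. even e_R \<and> -18 \<le> e_R \<and> e_R \<le> 20 \<and> e_R \<noteq> 0 \<longrightarrow>
        (\<lambda>g. ln (\<phi> e_R g) - 4 * pi * \<rho> e_R * sqrt (real g)) \<in> o(\<lambda>g. sqrt (real g)))
   \<and> (\<lambda>g. ln (\<phi> 0 (2 * g)) - 2 * pi * sqrt (real (2 * g))) \<in> o(\<lambda>g. sqrt (real g))"
proof (intro conjI allI impI)
  fix X :: "'a surface" and \<sigma> L g
  assume c: "real (complex_count X L) = fps_nth complex_series g"
    and w: "real_of_int (welschinger_count X \<sigma> L) = fps_nth (welschinger_series (euler_real X \<sigma>)) g"
  show "\<phi> (euler_real X \<sigma>) g = real_of_int \<bar>welschinger_count X \<sigma> L\<bar>"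
    by (simp add: \<phi>_def flip: w)
  show "real (complex_count X L) = \<psi> g"
    by (simp add: \<psi>_def c)
  \<comment> \<open>An infinite set has cardinality 0, so a positive count entails finiteness.\<close>
  have "0 < complex_count X L" using c complex_series_pos[of g] by simp
  then have "finite (rational_curves X L)"
    unfolding complex_count_def by (rule card_ge_0_finite)
  then show "\<bar>welschinger_count X \<sigma> L\<bar> \<le> int (real_count X \<sigma> L)"
      "real_count X \<sigma> L \<le> complex_count X L"
    by (rule welschinger_le_real_le_complex)+
qed (use log_complex_asymptotics log_welschinger_asymptotics log_welschinger_zero_asymptotics in auto)

end
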